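(* Let $m,d\in\mathbb N$, let $p=(p_0,\dots,p_{d-1})\in\mathrm{Int}[z_0,\dots,z_{m-1}]^d$, regarded as a function $p:\mathbb Z^m\to\mathbb Z^d$, with $p(0)=0$. Let $T$ be a finite rooted tree with root $r$ and $T^+=T\setminus\{r\}$, let $(g_n)_{n\in\omega}$ be a sequence of functions $g_n:T^+\to\mathbb Z^m$, and let $A\subseteq\mathbb Z^d$ have positive density. Then there exists a sequence of functions $b_n:T\to\mathrm{FIN}^T$, $t\mapsto b_{n,t}\in\mathrm{FIN}^T_t$, such that $\mathrm{dom}(b_{n,t})<\mathrm{dom}(b_{n+1,t})$ for all $n,t$, and for every finite nonempty $F\subseteq\omega$, regressive homomorphisms $f_e:T\to T$ and nodes $t_e\in T$ ($e\in F$) such that $\{f_e(t_e):e\in F\}$ is a chain in $T$, one has $$p\Big(\sum_{e\in F}\ \sum_{\substack{j\in\mathrm{dom}(b_{e,t_e})\\ (f_e\circ b_{e,t_e})(j)\in T^+}}\big(g_j\circ f_e\circ b_{e,t_e}\big)(j)\Big)\in A-A.$$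
   Context: $\mathrm{Int}[z_0,\dots,z_{m-1}]$ is the set of polynomials with rational coefficients in $z_0,\dots,z_{m-1}$ mapping $\mathbb Z^m$ into $\mathbb Z$. Density in the group $\mathbb Z^d$ (Banach density): for $\alpha>0$, $d(A)\ge\alpha$ iff for every finite $F\subseteq\mathbb Z^d$ and $\varepsilon>0$ there is finite $I\subseteq\mathbb Z^d$ with $|A\cap I|\ge(\alpha-\varepsilon)|I|$ and $|(g+I)\triangle I|<\varepsilon|I|$ for all $g\in F$; positive density means $d(A)\ge\alpha$ for some $\alpha>0$. $A-A=\{a-b:a,b\in A\}$. $\omega=\{0,1,\dots\}$; for finite $A,B\subseteq\omega$, $A<B$ means every element of $A$ is below every element of $B$ (vacuous if empty). $T$ is ordered by $t'\le t$ iff $t'$ is a descendant of or equal to $t$. A regressive homomorphism of $T$ is $f:T\to T$ with $f(t)\ge t$ mapping adjacent nodes to equal or adjacent nodes. $\mathrm{FIN}^T$: functions $b:\mathrm{dom}(b)\to T^+$, $\mathrm{dom}(b)$ a finite (possibly empty) subset of $\omega$, range in a branch of $T$; $\mathrm{FIN}^T_t$ ($t\in T^+$): those whose range is a nonempty chain with least element $t$; $\mathrm{FIN}^T_r=\{\emptyset\}$. *)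

theory Defs
  imports Complex_Main "HOL-Library.Poly_Mapping" "HOL-Library.Function_Algebras"
begin

text \<open>
  The group of integer vectors of length \<open>k\<close> (\<open>k = 0\<close> allowed): functions on all of \<open>nat\<close> that
  vanish from index \<open>k\<close> on. The pointwise \<open>+\<close>, \<open>-\<close>, \<open>0\<close> and \<open>\<Sum>\<close> on functions are then the
  vector operations.
\<close>

definition int_vecs :: "nat \<Rightarrow> (nat \<Rightarrow> int) set" where
  "int_vecs k = {x. \<forall>i\<ge>k. x i = 0}"

definition difference_set :: "(nat \<Rightarrow> int) set \<Rightarrow> (nat \<Rightarrow> int) set" where
  "difference_set A = {a - b | a b. a \<in> A \<and> b \<in> A}"

definition banach_density_ge :: "nat \<Rightarrow> (nat \<Rightarrow> int) set \<Rightarrow> real \<Rightarrow> bool" where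
  "banach_density_ge d A \<alpha> \<longleftrightarrow>
     (\<forall>F \<epsilon>. finite F \<and> F \<subseteq> int_vecs d \<and> \<epsilon> > 0 \<longrightarrow>
        (\<exists>I. finite I \<and> I \<subseteq> int_vecs d \<and>
             real (card (A \<inter> I)) \<ge> (\<alpha> - \<epsilon>) * real (card I) \<and>
             (\<forall>g\<in>F. real (card (sym_diff ((\<lambda>x. g + x) ` I) I)) < \<epsilon> * real (card I))))"

definition positive_density :: "nat \<Rightarrow> (nat \<Rightarrow> int) set \<Rightarrow> bool" where
  "positive_density d A \<longleftrightarrow> (\<exists>\<alpha>>0. banach_density_ge d A \<alpha>)"


text \<open>
  Polynomials over \<open>rat\<close> in variables indexed by \<open>nat\<close>: finitely supported maps from monomials
  (finitely supported exponent maps) to coefficients.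
\<close>

type_synonym rat_mpoly = "(nat \<Rightarrow>\<^sub>0 nat) \<Rightarrow>\<^sub>0 rat"

definition mpoly_in_vars :: "nat \<Rightarrow> rat_mpoly \<Rightarrow> bool" where
  "mpoly_in_vars m q \<longleftrightarrow> (\<forall>u \<in> Poly_Mapping.keys q. Poly_Mapping.keys u \<subseteq> {..<m})"

definition mpoly_eval :: "rat_mpoly \<Rightarrow> (nat \<Rightarrow> int) \<Rightarrow> rat" where
  "mpoly_eval q x =
     (\<Sum>u \<in> Poly_Mapping.keys q. Poly_Mapping.lookup q u *
        (\<Prod>i \<in> Poly_Mapping.keys u. rat_of_int (x i) ^ Poly_Mapping.lookup u i))"

definition int_valued_mpolys :: "nat \<Rightarrow> rat_mpoly set" where
  "int_valued_mpolys m = {q. mpoly_in_vars m q \<and> (\<forall>x \<in> int_vecs m. mpoly_eval q x \<in> \<int>)}"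

text \<open>
  For \<open>p i \<in> int_valued_mpolys m\<close> and \<open>x \<in> int_vecs m\<close> the floor is taken of an integer; it only
  converts from \<open>rat\<close> to \<open>int\<close>.
\<close>

definition mpoly_tuple_fun :: "nat \<Rightarrow> (nat \<Rightarrow> rat_mpoly) \<Rightarrow> (nat \<Rightarrow> int) \<Rightarrow> (nat \<Rightarrow> int)" where
  "mpoly_tuple_fun d p x = (\<lambda>i. if i < d then \<lfloor>mpoly_eval (p i) x\<rfloor> else 0)"


text \<open>
  A rooted tree is given by its nodes, its root and the parent of each non-root node (the value of
  \<open>parent\<close> elsewhere is irrelevant). That the root is reached from every node by passing to parents
  expresses connectedness and excludes cycles.
\<close>

record 'a rtree =
  nodes :: "'a set"
  root :: 'a
  parent :: "'a \<Rightarrow> 'a"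

definition nonroot :: "'a rtree \<Rightarrow> 'a set" where
  "nonroot T = nodes T - {root T}"

definition parent_edges :: "'a rtree \<Rightarrow> ('a \<times> 'a) set" where
  "parent_edges T = {(t, parent T t) | t. t \<in> nonroot T}"

definition finite_rooted_tree :: "'a rtree \<Rightarrow> bool" where
  "finite_rooted_tree T \<longleftrightarrow>
     finite (nodes T) \<and> root T \<in> nodes T \<and> parent T ` nonroot T \<subseteq> nodes T \<and>
     (\<forall>t \<in> nodes T. (t, root T) \<in> (parent_edges T)\<^sup>*)"

definition adjacent :: "'a rtree \<Rightarrow> 'a \<Rightarrow> 'a \<Rightarrow> bool" where
  "adjacent T s t \<longleftrightarrow> (s, t) \<in> parent_edges T \<or> (t, s) \<in> parent_edges T"

text \<open>\<open>tree_le T s t\<close>: \<open>s\<close> is a descendant of \<open>t\<close> or equal to it, so the root is the largest node.\<close>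

definition tree_le :: "'a rtree \<Rightarrow> 'a \<Rightarrow> 'a \<Rightarrow> bool" where
  "tree_le T s t \<longleftrightarrow> (s, t) \<in> (parent_edges T)\<^sup>*"

definition tree_chain :: "'a rtree \<Rightarrow> 'a set \<Rightarrow> bool" where
  "tree_chain T C \<longleftrightarrow> pred_on.chain (nodes T) (tree_le T) C"

definition tree_branch :: "'a rtree \<Rightarrow> 'a set \<Rightarrow> bool" where
  "tree_branch T B \<longleftrightarrow> pred_on.maxchain (nodes T) (tree_le T) B"

definition regressive_hom :: "'a rtree \<Rightarrow> ('a \<Rightarrow> 'a) \<Rightarrow> bool" where
  "regressive_hom T f \<longleftrightarrow>
     f ` nodes T \<subseteq> nodes T \<and>
     (\<forall>t \<in> nodes T. tree_le T t (f t)) \<and>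
     (\<forall>s \<in> nodes T. \<forall>t \<in> nodes T. adjacent T s t \<longrightarrow> f s = f t \<or> adjacent T (f s) (f t))"

definition FIN :: "'a rtree \<Rightarrow> (nat \<rightharpoonup> 'a) set" where
  "FIN T = {b. finite (dom b) \<and> ran b \<subseteq> nonroot T \<and> (\<exists>B. tree_branch T B \<and> ran b \<subseteq> B)}"

definition FIN_at :: "'a rtree \<Rightarrow> 'a \<Rightarrow> (nat \<rightharpoonup> 'a) set" where
  "FIN_at T t =
     (if t = root T then {Map.empty}
      else {b \<in> FIN T. ran b \<noteq> {} \<and> tree_chain T (ran b) \<and>
              t \<in> ran b \<and> (\<forall>s \<in> ran b. tree_le T t s)})"

definition set_below :: "nat set \<Rightarrow> nat set \<Rightarrow> bool" where
  "set_below A B \<longleftrightarrow> (\<forall>a\<in>A. \<forall>b\<in>B. a < b)"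

end

theory Submission
  imports Defs
begin

text \<open>
  Take every \<open>b\<^sub>n\<^sub>,\<^sub>t\<close> constant with value \<open>t\<close> on a block \<open>D\<^sub>n\<close> that does not depend on \<open>t\<close>. It then
  suffices that \<open>p\<close> maps every sum over \<open>e \<in> F\<close> of \<open>\<Sum>j\<in>D\<^sub>e. g\<^sub>j(s\<^sub>e)\<close> into \<open>A - A\<close>, for all
  \<open>s\<^sub>e \<in> T\<^sup>+\<close>.

  The density of \<open>A\<close> gives a positive definite \<open>\<phi>\<close> on \<open>\<int>\<^sup>d\<close> which is negative, bounded away from \<open>0\<close>,
  off \<open>A - A\<close>. An idempotent ultrafilter on the finite subsets of \<open>\<omega>\<close> yields for each \<open>s\<close> an
  idempotent ultrafilter \<open>U\<^sub>s\<close> on \<open>\<int>\<^sup>m\<close>. By induction on the degree of the polynomial map \<open>q\<close>, the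
  operator \<open>\<phi> \<mapsto> lim \<phi>(x + q(w))\<close>, \<open>w \<rightarrow> U\<^sub>s\<close>, acts on positive definite functions as an orthogonal
  projection: since polynomial maps of bounded degree form a Noetherian group, \<open>\<phi>\<close> splits
  into parts on which each operator of lower degree is the identity or \<open>0\<close>, and on such a part
  either \<open>q\<close> behaves additively or the van der Corput argument makes the limit vanish. On a
  part which is so for all \<open>s\<close> at once, any iterated limit of \<open>\<phi>(q(v\<^sub>1 + \<dots> + v\<^sub>l))\<close> is \<open>\<phi>(0)\<close> or \<open>0\<close>,
  so all iterated limits of \<open>\<phi> \<circ> p\<close> are nonnegative, even those in which the later ultrafilters
  depend on the earlier points. This uniformity permits choosing the \<open>D\<^sub>n\<close> one after another.
\<close>

section \<open>Ultrafilters\<close>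

definition ultrafilter :: "'a filter \<Rightarrow> bool" where
  "ultrafilter F \<longleftrightarrow> F \<noteq> bot \<and> (\<forall>P. eventually P F \<or> eventually (\<lambda>x. \<not> P x) F)"

lemma ultrafilter_nontrivial: "ultrafilter F \<Longrightarrow> F \<noteq> bot"
  by (simp add: ultrafilter_def)

lemma ultrafilter_not_iff:
  assumes "ultrafilter F"
  shows "eventually (\<lambda>x. \<not> P x) F \<longleftrightarrow> \<not> eventually P F"
  using assms eventually_conj[of P F "\<lambda>x. \<not> P x"]
  by (auto simp: ultrafilter_def trivial_limit_def)

lemma ultrafilter_filtermap:
  "ultrafilter F \<Longrightarrow> ultrafilter (filtermap f F)"
  by (auto simp: ultrafilter_def eventually_filtermap filtermap_bot_iff)

text \<open>Zorn's lemma below \<open>F\<close>. In the infimum of a nonempty chain an event holds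
  iff it holds in some member, so \<open>Q\<close> can be checked there member by member.\<close>

lemma minimal_filter_exists:
  fixes F :: "'a filter"
  assumes "Q F"
    and chain: "\<And>C. C \<noteq> {} \<Longrightarrow> (\<And>G. G \<in> C \<Longrightarrow> Q G) \<Longrightarrow>
      (\<And>P. eventually P (Inf C) \<longleftrightarrow> (\<exists>G\<in>C. eventually P G)) \<Longrightarrow> Q (Inf C)"
  shows "\<exists>G\<le>F. Q G \<and> (\<forall>H\<le>G. Q H \<longrightarrow> H = G)"
proof -
  let ?A = "{G. Q G \<and> G \<le> F}"
  have "\<exists>m\<in>?A. \<forall>a\<in>?A. m \<ge> a \<longrightarrow> a = m"
  proof (rule predicate_Zorn)
    show "partial_order_on ?A (relation_of (\<ge>) ?A)"
      by (auto simp: partial_order_on_def preorder_on_def refl_on_def trans_def antisym_def relation_of_def)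
    fix C assume C: "C \<in> Chains (relation_of (\<ge>) ?A)"
    show "\<exists>u\<in>?A. \<forall>a\<in>C. a \<ge> u"
    proof (cases "C = {}")
      case True
      then show ?thesis using \<open>Q F\<close> by auto
    next
      case False
      have sub: "C \<subseteq> ?A" using C by (auto simp: Chains_def relation_of_def)
      have lin: "G \<le> H \<or> H \<le> G" if "G \<in> C" "H \<in> C" for G H
        using C that by (auto simp: Chains_def relation_of_def)
      have "eventually P (Inf C) \<longleftrightarrow> (\<exists>G\<in>C. eventually P G)" for P
        using False lin by (intro eventually_Inf_base) (auto simp: le_inf_iff)
      then have "Q (Inf C)" using sub False by (intro chain) auto
      moreover have "Inf C \<le> F" using False sub by (auto intro: Inf_lower2)
      ultimately show ?thesis by (auto intro!: bexI[of _ "Inf C"] Inf_lower)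
    qed
  qed
  then show ?thesis by (metis (mono_tags, lifting) mem_Collect_eq order_trans)
qed

lemma ultrafilter_exists:
  assumes "F \<noteq> bot"
  shows "\<exists>G\<le>F. ultrafilter G"
proof -
  have "\<exists>G\<le>F. G \<noteq> bot \<and> (\<forall>H\<le>G. H \<noteq> bot \<longrightarrow> H = G)"
    by (rule minimal_filter_exists[of "\<lambda>G. G \<noteq> bot"])
      (use assms in \<open>auto simp: trivial_limit_def\<close>)
  then obtain G where G: "G \<le> F" "G \<noteq> bot" "\<And>H. H \<le> G \<Longrightarrow> H \<noteq> bot \<Longrightarrow> H = G" by blast
  have "eventually P G \<or> eventually (\<lambda>x. \<not> P x) G" for P
  proof (cases "inf G (principal {x. P x}) = bot")
    case True
    then show ?thesis
      by (simp add: trivial_limit_def eventually_inf_principal)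
  next
    case False
    then have "inf G (principal {x. P x}) = G" by (intro G) auto
    then have "G \<le> principal {x. P x}" by (metis inf.cobounded2)
    then show ?thesis by (simp add: le_principal)
  qed
  then show ?thesis using G by (auto simp: ultrafilter_def)
qed

section \<open>Products of filters and idempotent ultrafilters\<close>

text \<open>The product of the semigroup of ultrafilters, extended to all filters so that
  \<open>F * F \<le> F\<close> makes sense before maximality is known.\<close>

definition conv_filter :: "('a \<Rightarrow> 'a \<Rightarrow> 'a) \<Rightarrow> 'a filter \<Rightarrow> 'a filter \<Rightarrow> 'a filter" where
  "conv_filter f F G = Abs_filter (\<lambda>P. \<forall>\<^sub>F x in F. \<forall>\<^sub>F y in G. P (f x y))"

lemma eventually_conv_filter:
  "eventually P (conv_filter f F G) \<longleftrightarrow> (\<forall>\<^sub>F x in F. \<forall>\<^sub>F y in G. P (f x y))"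
  unfolding conv_filter_def
proof (rule eventually_Abs_filter, rule is_filter.intro)
  fix P Q :: "'a \<Rightarrow> bool"
  assume "\<forall>\<^sub>F x in F. \<forall>\<^sub>F y in G. P (f x y)" "\<forall>\<^sub>F x in F. \<forall>\<^sub>F y in G. Q (f x y)"
  then show "\<forall>\<^sub>F x in F. \<forall>\<^sub>F y in G. P (f x y) \<and> Q (f x y)"
    by eventually_elim (rule eventually_conj)
next
  fix P Q :: "'a \<Rightarrow> bool"
  assume "\<forall>x. P x \<longrightarrow> Q x" "\<forall>\<^sub>F x in F. \<forall>\<^sub>F y in G. P (f x y)"
  then show "\<forall>\<^sub>F x in F. \<forall>\<^sub>F y in G. Q (f x y)"
    by (auto elim!: eventually_mono)
qed simp

definition idempotent_ultrafilter :: "('a \<Rightarrow> 'a \<Rightarrow> 'a) \<Rightarrow> 'a filter \<Rightarrow> bool" where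
  "idempotent_ultrafilter f U \<longleftrightarrow> ultrafilter U \<and>
     (\<forall>P. (\<forall>\<^sub>F x in U. P x) \<longleftrightarrow> (\<forall>\<^sub>F x in U. \<forall>\<^sub>F y in U. P (f x y)))"

text \<open>
  A minimal filter \<open>F\<close> with \<open>F * F \<le> F\<close> is an ultrafilter: for an ultrafilter \<open>p \<le> F\<close>, first
  \<open>F * p = F\<close> by minimality, and then the filter generated by \<open>F\<close> and the sets
  \<open>{x. x\<^sup>-\<^sup>1 A \<in> p}\<close> with \<open>A \<in> p\<close> also equals \<open>F\<close>, whence \<open>F \<le> p\<close>.
\<close>

lemma idempotent_ultrafilter_exists:
  fixes f :: "'a \<Rightarrow> 'a \<Rightarrow> 'a"
  assumes assoc: "\<And>x y z. f (f x y) z = f x (f y z)"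
    and "H \<noteq> bot" and "conv_filter f H H \<le> H"
  shows "\<exists>U\<le>H. idempotent_ultrafilter f U"
proof -
  define Q where "Q F \<longleftrightarrow> F \<noteq> bot \<and> conv_filter f F F \<le> F" for F
  have Qev: "\<forall>\<^sub>F x in F. \<forall>\<^sub>F y in F. P (f x y)" if "Q F" "eventually P F" for F P
    using that by (auto simp: Q_def le_filter_def eventually_conv_filter)
  have "\<exists>G\<le>H. Q G \<and> (\<forall>K\<le>G. Q K \<longrightarrow> K = G)"
  proof (rule minimal_filter_exists)
    show "Q H" using assms by (simp add: Q_def)
    fix C assume "C \<noteq> {}" and QC: "\<And>G. G \<in> C \<Longrightarrow> Q G"
      and ev: "\<And>P. eventually P (Inf C) \<longleftrightarrow> (\<exists>G\<in>C. eventually P G)"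
    show "Q (Inf C)"
      unfolding Q_def
    proof (intro conjI)
      show "Inf C \<noteq> bot" using QC by (auto simp: trivial_limit_def ev Q_def)
      show "conv_filter f (Inf C) (Inf C) \<le> Inf C"
        unfolding le_filter_def
      proof (intro allI impI)
        fix P assume "eventually P (Inf C)"
        then obtain G where G: "G \<in> C" "eventually P G" by (auto simp: ev)
        then have "\<forall>\<^sub>F x in G. \<forall>\<^sub>F y in G. P (f x y)" using QC Qev by blast
        then have "\<forall>\<^sub>F x in G. \<forall>\<^sub>F y in Inf C. P (f x y)"
          by eventually_elim (use G(1) in \<open>auto simp: ev\<close>)
        then show "eventually P (conv_filter f (Inf C) (Inf C))"
          using G(1) by (auto simp: eventually_conv_filter ev)
      qed
    qed
  qed
  then obtain F where "F \<le> H" and F: "Q F" and min: "\<And>K. K \<le> F \<Longrightarrow> Q K \<Longrightarrow> K = F" by blast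
  from F have "F \<noteq> bot" by (simp add: Q_def)
  then obtain p where p: "p \<le> F" "ultrafilter p" using ultrafilter_exists by blast
  have pF: "eventually P p" if "eventually P F" for P
    using p(1) that by (auto simp: le_filter_def)
  have 1: "conv_filter f F p = F"
  proof (rule min)
    show "conv_filter f F p \<le> F"
      unfolding le_filter_def eventually_conv_filter
    proof (intro allI impI)
      fix P assume "eventually P F"
      then have "\<forall>\<^sub>F x in F. \<forall>\<^sub>F y in F. P (f x y)" by (rule Qev[OF F])
      then show "\<forall>\<^sub>F x in F. \<forall>\<^sub>F y in p. P (f x y)" by eventually_elim (rule pF)
    qed
    show "Q (conv_filter f F p)"
      unfolding Q_def le_filter_def eventually_conv_filter
    proof (intro conjI allI impI)
      show "conv_filter f F p \<noteq> bot"
        using \<open>F \<noteq> bot\<close> ultrafilter_nontrivial[OF p(2)]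
        by (simp add: trivial_limit_def[of "conv_filter f F p"] eventually_conv_filter)
      \<comment> \<open>Splitting the first factor twice gives limits along \<open>F\<close>,
        \<open>F\<close>, \<open>F\<close> and \<open>p\<close>; the second may be taken along the
        finer \<open>p\<close>, and reassociation yields the product of \<open>F * p\<close> with
        itself.\<close>
      fix P assume "\<forall>\<^sub>F x in F. \<forall>\<^sub>F y in p. P (f x y)"
      then have "\<forall>\<^sub>F a in F. \<forall>\<^sub>F c in F. \<forall>\<^sub>F y in p. P (f (f a c) y)" by (rule Qev[OF F])
      then have "\<forall>\<^sub>F a in F. \<forall>\<^sub>F b in F. \<forall>\<^sub>F c in F. \<forall>\<^sub>F y in p. P (f (f a (f b c)) y)"
        by eventually_elim (rule Qev[OF F])
      then show "\<forall>\<^sub>F a in F. \<forall>\<^sub>F b in p. \<forall>\<^sub>F c in F. \<forall>\<^sub>F y in p. P (f (f a b) (f c y))"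
        unfolding assoc by eventually_elim (rule pF)
    qed
  qed
  define ev where "ev P \<longleftrightarrow> (\<exists>B A. eventually B F \<and> eventually A p \<and>
    (\<forall>x. B x \<longrightarrow> (\<forall>\<^sub>F y in p. A (f x y)) \<longrightarrow> P x))" for P
  define G where "G = Abs_filter ev"
  have evG: "eventually P G \<longleftrightarrow> ev P" for P
    unfolding G_def
  proof (rule eventually_Abs_filter, rule is_filter.intro)
    show "ev (\<lambda>x. True)" unfolding ev_def by (intro exI[of _ "\<lambda>_. True"]) auto
    show "ev P \<Longrightarrow> ev P'" if "\<forall>x. P x \<longrightarrow> P' x" for P P'
      unfolding ev_def using that by metis
    fix P P' assume "ev P" "ev P'"
    then obtain B A B' A' where *: "eventually B F" "eventually A p" "eventually B' F" "eventually A' p"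
      "\<forall>x. B x \<longrightarrow> (\<forall>\<^sub>F y in p. A (f x y)) \<longrightarrow> P x" "\<forall>x. B' x \<longrightarrow> (\<forall>\<^sub>F y in p. A' (f x y)) \<longrightarrow> P' x"
      unfolding ev_def by blast
    then show "ev (\<lambda>x. P x \<and> P' x)"
      unfolding ev_def
      by (intro exI[of _ "\<lambda>x. B x \<and> B' x"] exI[of _ "\<lambda>x. A x \<and> A' x"])
        (auto intro: eventually_conj simp: eventually_conj_iff)
  qed
  have GA: "\<forall>\<^sub>F x in G. \<forall>\<^sub>F y in p. A (f x y)" if "eventually A p" for A
    unfolding evG ev_def using that by (intro exI[of _ "\<lambda>_. True"] exI[of _ A]) auto
  have GF: "eventually B G" if "eventually B F" for B
    unfolding evG ev_def using that by (intro exI[of _ B] exI[of _ "\<lambda>_. True"]) auto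
  have "G = F"
  proof (rule min)
    show "G \<le> F" using GF by (simp add: le_filter_def)
    show "Q G"
      unfolding Q_def
    proof (intro conjI)
      show "G \<noteq> bot"
      proof
        assume "G = bot"
        then obtain B A where *: "eventually B F" "eventually A p"
          "\<And>x. B x \<Longrightarrow> \<not> (\<forall>\<^sub>F y in p. A (f x y))"
          using evG[of "\<lambda>_. False"] by (auto simp: ev_def)
        from *(1) have "\<forall>\<^sub>F x in F. \<forall>\<^sub>F y in p. \<not> A (f x y)"
          by eventually_elim (simp add: *(3) ultrafilter_not_iff[OF p(2)])
        then have "\<forall>\<^sub>F x in conv_filter f F p. \<not> A x" by (simp add: eventually_conv_filter)
        then have "\<forall>\<^sub>F x in p. \<not> A x" unfolding 1 by (rule pF)
        with *(2) show False by (simp add: ultrafilter_not_iff[OF p(2)])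
      qed
      show "conv_filter f G G \<le> G"
        unfolding le_filter_def
      proof (intro allI impI)
        fix P assume "eventually P G"
        then obtain B A where *: "eventually B F" "eventually A p"
          "\<And>x. B x \<Longrightarrow> \<forall>\<^sub>F y in p. A (f x y) \<Longrightarrow> P x"
          unfolding evG ev_def by blast
        have "\<forall>\<^sub>F x in F. \<forall>\<^sub>F y in F. B (f x y)" by (rule Qev[OF F *(1)])
        then have "\<forall>\<^sub>F x in F. \<forall>\<^sub>F y in G. B (f x y)" by eventually_elim (rule GF)
        then have "\<forall>\<^sub>F x in G. \<forall>\<^sub>F y in G. B (f x y)" by (rule GF)
        moreover from GA[OF *(2)]
        have "\<forall>\<^sub>F x in G. \<forall>\<^sub>F y in G. \<forall>\<^sub>F z in p. A (f x (f y z))"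
          by eventually_elim (rule GA)
        ultimately have "\<forall>\<^sub>F x in G. \<forall>\<^sub>F y in G. P (f x y)"
        proof eventually_elim
          case (elim x)
          from elim show ?case by eventually_elim (simp add: *(3) assoc)
        qed
        then show "eventually P (conv_filter f G G)" by (simp add: eventually_conv_filter)
      qed
    qed
  qed
  have "F \<le> p"
    unfolding le_filter_def
  proof (intro allI impI)
    fix A assume "eventually A p"
    then have "\<forall>\<^sub>F x in F. \<forall>\<^sub>F y in p. A (f x y)" using GA \<open>G = F\<close> by blast
    then show "eventually A F" by (simp flip: eventually_conv_filter add: 1)
  qed
  with p have ultra: "ultrafilter F" by (simp add: antisym)
  have "(\<forall>\<^sub>F x in F. P x) \<longleftrightarrow> (\<forall>\<^sub>F x in F. \<forall>\<^sub>F y in F. P (f x y))" for P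
  proof
    assume *: "\<forall>\<^sub>F x in F. \<forall>\<^sub>F y in F. P (f x y)"
    show "eventually P F"
    proof (rule ccontr)
      assume "\<not> eventually P F"
      then have "\<forall>\<^sub>F x in F. \<not> P x" by (simp add: ultrafilter_not_iff[OF ultra])
      then have "\<forall>\<^sub>F x in F. \<forall>\<^sub>F y in F. \<not> P (f x y)" by (rule Qev[OF F])
      then show False using * by (simp add: ultrafilter_not_iff[OF ultra])
    qed
  qed (rule Qev[OF F])
  with ultra \<open>F \<le> H\<close> show ?thesis by (auto simp: idempotent_ultrafilter_def)
qed

section \<open>Limits of bounded functions along an ultrafilter\<close>

definition ulim :: "'a filter \<Rightarrow> ('a \<Rightarrow> real) \<Rightarrow> real" where
  "ulim U f = Lim U f"

text \<open>The limit is the supremum of the eventual lower bounds: a level that is not an eventual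
  lower bound is eventually strictly above \<open>f\<close>.\<close>

lemma tendsto_ulim:
  assumes U: "ultrafilter U" and B: "\<forall>\<^sub>F x in U. \<bar>f x\<bar> \<le> B"
  shows "(f \<longlongrightarrow> ulim U f) U"
proof -
  let ?S = "{a. \<forall>\<^sub>F x in U. a \<le> f x}"
  define L where "L = Sup ?S"
  have mem: "-B \<in> ?S" using B by (auto elim!: eventually_mono)
  have up: "a \<le> B" if "a \<in> ?S" for a
  proof -
    from that have "\<forall>\<^sub>F x in U. a \<le> f x" by simp
    with B have "\<forall>\<^sub>F x in U. a \<le> B" by eventually_elim auto
    then show ?thesis using U by (simp add: ultrafilter_def)
  qed
  have bdd: "bdd_above ?S" using up by (auto intro!: bdd_aboveI)
  have "(f \<longlongrightarrow> L) U"
  proof (rule order_tendstoI)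
    fix a assume "a < L"
    then obtain b where "b \<in> ?S" "a < b"
      using less_cSup_iff[of ?S a] mem bdd unfolding L_def by auto
    then show "\<forall>\<^sub>F x in U. a < f x" by (auto elim!: eventually_mono)
  next
    fix a assume "L < a"
    then have "a \<notin> ?S" using cSup_upper[OF _ bdd] unfolding L_def by fastforce
    then show "\<forall>\<^sub>F x in U. f x < a"
      using ultrafilter_not_iff[OF U, of "\<lambda>x. a \<le> f x"] by (simp add: not_le)
  qed
  then show ?thesis
    using tendsto_Lim[of U f L] U by (simp add: ulim_def ultrafilter_def)
qed

lemma ulim_eqI: "ultrafilter U \<Longrightarrow> (f \<longlongrightarrow> L) U \<Longrightarrow> ulim U f = L"
  by (simp add: ulim_def tendsto_Lim ultrafilter_def)

lemma ulim_const [simp]: "ultrafilter U \<Longrightarrow> ulim U (\<lambda>_. c) = c"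
  by (simp add: ulim_eqI)

lemma ulim_cong: "\<forall>\<^sub>F x in U. f x = g x \<Longrightarrow> ulim U f = ulim U g"
  unfolding ulim_def by (rule Lim_cong) auto

lemma ulim_abs_le:
  assumes "ultrafilter U" "\<forall>\<^sub>F x in U. \<bar>f x\<bar> \<le> B"
  shows "\<bar>ulim U f\<bar> \<le> B"
  using tendsto_upperbound[OF tendsto_rabs[OF tendsto_ulim[OF assms]] assms(2)] assms(1)
  by (simp add: ultrafilter_def)

lemma ulim_add:
  assumes "ultrafilter U" "\<forall>\<^sub>F x in U. \<bar>f x\<bar> \<le> B" "\<forall>\<^sub>F x in U. \<bar>g x\<bar> \<le> C"
  shows "ulim U (\<lambda>x. f x + g x) = ulim U f + ulim U g"
  using assms by (intro ulim_eqI tendsto_add tendsto_ulim)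

lemma ulim_mono:
  assumes "ultrafilter U" "\<forall>\<^sub>F x in U. \<bar>f x\<bar> \<le> B" "\<forall>\<^sub>F x in U. \<bar>g x\<bar> \<le> C" "\<forall>\<^sub>F x in U. f x \<le> g x"
  shows "ulim U f \<le> ulim U g"
  using assms by (intro tendsto_le[OF ultrafilter_nontrivial tendsto_ulim tendsto_ulim])

section \<open>Positive definite functions\<close>

text \<open>With real coefficients the quadratic form sees only the symmetric part of its kernel, so
  symmetry is a separate clause.\<close>

definition posdef :: "('g::ab_group_add \<Rightarrow> real) \<Rightarrow> bool" where
  "posdef \<phi> \<longleftrightarrow> (\<forall>x. \<phi> (- x) = \<phi> x) \<and>
     (\<forall>(n::nat) a x. 0 \<le> (\<Sum>i<n. \<Sum>j<n. a i * a j * \<phi> (x i - x j)))"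

lemma posdef_minus: "posdef \<phi> \<Longrightarrow> \<phi> (- x) = \<phi> x"
  by (simp add: posdef_def)

lemma posdef_minus_commute: "posdef \<phi> \<Longrightarrow> \<phi> (x - y) = \<phi> (y - x)"
  using posdef_minus[of \<phi> "y - x"] by simp

lemma posdef_sum:
  assumes "posdef \<phi>" "finite I"
  shows "0 \<le> (\<Sum>i\<in>I. \<Sum>j\<in>I. a i * a j * \<phi> (x i - x j))"
proof -
  obtain h where h: "bij_betw h {0..<card I} I"
    using ex_bij_betw_nat_finite[OF assms(2)] by blast
  have "0 \<le> (\<Sum>i<card I. \<Sum>j<card I. a (h i) * a (h j) * \<phi> (x (h i) - x (h j)))"
    using assms(1) by (simp add: posdef_def)
  also have "\<dots> = (\<Sum>i\<in>I. \<Sum>j\<in>I. a i * a j * \<phi> (x i - x j))"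
    unfolding lessThan_atLeast0 sum.reindex_bij_betw[OF h, of "\<lambda>j. a (h _) * a j * \<phi> (x (h _) - x j)"]
    by (rule sum.reindex_bij_betw[OF h])
  finally show ?thesis .
qed

lemma posdef_zero_nonneg: "posdef \<phi> \<Longrightarrow> 0 \<le> \<phi> 0"
  using posdef_sum[of \<phi> "{()}" "\<lambda>_. 1" "\<lambda>_. 0"] by simp

lemma discriminant_bound:
  fixes p q s :: real
  assumes "\<And>t. 0 \<le> p * t\<^sup>2 + 2 * t * s + q" "0 \<le> p"
  shows "s\<^sup>2 \<le> p * q"
proof (cases "p = 0")
  case True
  have "s = 0"
  proof (rule ccontr)
    assume "s \<noteq> 0"
    then have "2 * (- (\<bar>q\<bar> + 1) / (2 * s)) * s = - (\<bar>q\<bar> + 1)" by simp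
    then show False using assms(1)[of "- (\<bar>q\<bar> + 1) / (2 * s)"] True by simp
  qed
  then show ?thesis using True by simp
next
  case False
  then show ?thesis using assms(1)[of "- s / p"] assms(2)
    by (simp add: field_simps power2_eq_square)
qed

text \<open>Adjoining the point \<open>y\<close>, indexed by \<open>None\<close>, with weight
  \<open>t\<close> makes the form a nonnegative quadratic polynomial in \<open>t\<close>; its
  discriminant gives the bound.\<close>

lemma posdef_Cauchy_Schwarz:
  assumes \<phi>: "posdef \<phi>" and "finite I"
  shows "(\<Sum>i\<in>I. a i * \<phi> (x i - y))\<^sup>2 \<le> \<phi> 0 * (\<Sum>i\<in>I. \<Sum>j\<in>I. a i * a j * \<phi> (x i - x j))"
proof (rule discriminant_bound)
  fix t :: real
  let ?I = "insert None (Some ` I)"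
  let ?a = "case_option t a" and ?x = "case_option y x"
  have "0 \<le> (\<Sum>i\<in>?I. \<Sum>j\<in>?I. ?a i * ?a j * \<phi> (?x i - ?x j))"
    using assms by (intro posdef_sum) auto
  also have "\<dots> = \<phi> 0 * t\<^sup>2 + 2 * t * (\<Sum>i\<in>I. a i * \<phi> (x i - y)) +
      (\<Sum>i\<in>I. \<Sum>j\<in>I. a i * a j * \<phi> (x i - x j))"
    using \<open>finite I\<close>
    by (simp add: sum.reindex sum.distrib sum_distrib_left power2_eq_square mult_ac
        posdef_minus_commute[OF \<phi>, of y])
  finally show "0 \<le> \<phi> 0 * t\<^sup>2 + 2 * t * (\<Sum>i\<in>I. a i * \<phi> (x i - y)) +
      (\<Sum>i\<in>I. \<Sum>j\<in>I. a i * a j * \<phi> (x i - x j))" .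
qed (rule posdef_zero_nonneg[OF \<phi>])

lemma posdef_abs_le:
  assumes "posdef \<phi>"
  shows "\<bar>\<phi> x\<bar> \<le> \<phi> 0"
  using posdef_Cauchy_Schwarz[OF assms, of "{()}" "\<lambda>_. 1" "\<lambda>_. x" 0] posdef_zero_nonneg[OF assms]
  by (simp add: power2_eq_square[of "\<phi> 0", symmetric] abs_le_square_iff[symmetric])

text \<open>Cauchy-Schwarz with weights \<open>1\<close> and \<open>-1\<close> at
  \<open>x + y\<close> and \<open>x\<close>. The bound does not depend on \<open>x\<close>.\<close>

lemma posdef_Krein:
  assumes \<phi>: "posdef \<phi>"
  shows "(\<phi> (x + y) - \<phi> x)\<^sup>2 \<le> 2 * \<phi> 0 * (\<phi> 0 - \<phi> y)"
  using posdef_Cauchy_Schwarz[OF \<phi>, of "{True, False}" "\<lambda>b. if b then 1 else -1"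
      "\<lambda>b. if b then x + y else x" 0] posdef_minus[OF \<phi>, of y]
  by (simp add: algebra_simps)

lemma posdef_eq_0: "posdef \<phi> \<Longrightarrow> \<phi> 0 \<le> 0 \<Longrightarrow> \<phi> = (\<lambda>_. 0)"
  using posdef_abs_le[of \<phi>] by (intro ext) (smt (verit))

lemma posdef_add: "posdef \<phi> \<Longrightarrow> posdef \<psi> \<Longrightarrow> posdef (\<lambda>x. \<phi> x + \<psi> x)"
  by (auto simp: posdef_def ring_distribs sum.distrib)

lemma posdef_limit:
  assumes "F \<noteq> bot" "\<forall>\<^sub>F n in F. posdef (f n)" "\<And>x. ((\<lambda>n. f n x) \<longlongrightarrow> \<phi> x) F"
  shows "posdef \<phi>"
  unfolding posdef_def
proof (intro conjI allI)
  fix x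
  have "((\<lambda>n. f n x) \<longlongrightarrow> \<phi> (- x)) F"
    using assms(3)[of "-x"] by (rule Lim_transform_eventually)
      (use assms(2) in eventually_elim, simp add: posdef_minus)
  then show "\<phi> (- x) = \<phi> x" using assms tendsto_unique by blast
next
  fix n :: nat and a x
  show "0 \<le> (\<Sum>i<n. \<Sum>j<n. a i * a j * \<phi> (x i - x j))"
  proof (rule tendsto_lowerbound[OF _ _ assms(1)])
    show "((\<lambda>k. \<Sum>i<n. \<Sum>j<n. a i * a j * f k (x i - x j)) \<longlongrightarrow> (\<Sum>i<n. \<Sum>j<n. a i * a j * \<phi> (x i - x j))) F"
      by (intro tendsto_intros assms)
    show "\<forall>\<^sub>F k in F. 0 \<le> (\<Sum>i<n. \<Sum>j<n. a i * a j * f k (x i - x j))"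
      using assms(2) by eventually_elim (simp add: posdef_def)
  qed
qed

text \<open>
  If \<open>\<phi> z = \<langle>T\<^sup>z f, f\<rangle>\<close> for a unitary representation \<open>T\<close>, then \<open>twist I a x \<phi>\<close> is the function
  belonging to the vector \<open>\<Sum>i\<in>I. a i T\<^sup>x\<^sup>i f\<close>.
\<close>

definition twist :: "'i set \<Rightarrow> ('i \<Rightarrow> real) \<Rightarrow> ('i \<Rightarrow> 'g::ab_group_add) \<Rightarrow> ('g \<Rightarrow> real) \<Rightarrow> 'g \<Rightarrow> real" where
  "twist I a x \<phi> z = (\<Sum>i\<in>I. \<Sum>j\<in>I. a i * a j * \<phi> (x i - x j + z))"

lemma posdef_twist:
  fixes \<phi> :: "'g::ab_group_add \<Rightarrow> real"
  assumes \<phi>: "posdef \<phi>" and "finite I"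
  shows "posdef (twist I a x \<phi>)"
  unfolding posdef_def
proof (intro conjI allI)
  fix z
  have "twist I a x \<phi> (- z) = (\<Sum>i\<in>I. \<Sum>j\<in>I. a j * a i * \<phi> (x j - x i + z))"
    unfolding twist_def using posdef_minus_commute[OF \<phi>, of "x _ - x _" z]
    by (intro sum.cong refl) (simp add: algebra_simps)
  also have "\<dots> = twist I a x \<phi> z" unfolding twist_def by (rule sum.swap)
  finally show "twist I a x \<phi> (- z) = twist I a x \<phi> z" .
next
  fix n :: nat and b :: "nat \<Rightarrow> real" and z :: "nat \<Rightarrow> 'g"
  let ?K = "{..<n} \<times> I"
  let ?b = "\<lambda>p. b (fst p) * a (snd p)" and ?z = "\<lambda>p. x (snd p) + z (fst p)"
  have "0 \<le> (\<Sum>p\<in>?K. \<Sum>q\<in>?K. ?b p * ?b q * \<phi> (?z p - ?z q))"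
    using assms by (intro posdef_sum) auto
  also have "\<dots> = (\<Sum>k<n. \<Sum>i\<in>I. \<Sum>l<n. \<Sum>j\<in>I. b k * b l * (a i * a j * \<phi> (x i - x j + (z k - z l))))"
    by (simp add: sum.cartesian_product' algebra_simps)
  also have "\<dots> = (\<Sum>k<n. \<Sum>l<n. \<Sum>i\<in>I. \<Sum>j\<in>I. b k * b l * (a i * a j * \<phi> (x i - x j + (z k - z l))))"
    by (intro sum.cong refl sum.swap)
  also have "\<dots> = (\<Sum>k<n. \<Sum>l<n. b k * b l * twist I a x \<phi> (z k - z l))"
    by (simp add: twist_def sum_distrib_left)
  finally show "0 \<le> (\<Sum>k<n. \<Sum>l<n. b k * b l * twist I a x \<phi> (z k - z l))" .
qed

section \<open>Limit operators on positive definite functions\<close>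

text \<open>If \<open>\<phi> z\<close> is the inner product of \<open>T^z f\<close> and
  \<open>f\<close>, this is the inner product of \<open>P T^x f\<close> and \<open>f\<close>, where
  \<open>P\<close> is the weak limit of the unitaries \<open>T^(q w)\<close> along
  \<open>U\<close>.\<close>

definition qlim :: "'v filter \<Rightarrow> ('v \<Rightarrow> 'g::ab_group_add) \<Rightarrow> ('g \<Rightarrow> real) \<Rightarrow> 'g \<Rightarrow> real" where
  "qlim U q \<phi> x = ulim U (\<lambda>w. \<phi> (x + q w))"

lemma tendsto_qlim:
  assumes "ultrafilter U" "posdef \<phi>"
  shows "((\<lambda>w. \<phi> (x + q w)) \<longlongrightarrow> qlim U q \<phi> x) U"
  unfolding qlim_def using assms by (intro tendsto_ulim[of _ _ "\<phi> 0"]) (auto simp: posdef_abs_le)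

lemma abs_qlim_le: "ultrafilter U \<Longrightarrow> posdef \<phi> \<Longrightarrow> \<bar>qlim U q \<phi> x\<bar> \<le> \<phi> 0"
  unfolding qlim_def by (intro ulim_abs_le) (auto simp: posdef_abs_le)

lemma qlim_add:
  assumes "ultrafilter U" "posdef \<phi>" "posdef \<psi>"
  shows "qlim U q (\<lambda>x. \<phi> x + \<psi> x) = (\<lambda>x. qlim U q \<phi> x + qlim U q \<psi> x)"
  using assms by (intro ext) (auto simp: qlim_def posdef_abs_le intro!: ulim_add[of _ _ "\<phi> 0" _ "\<psi> 0"])

lemma qlim_zero [simp]: "ultrafilter U \<Longrightarrow> qlim U q (\<lambda>_. 0) = (\<lambda>_. 0)"
  by (simp add: qlim_def fun_eq_iff)

text \<open>Since \<open>posdef_Krein\<close> is uniform in the base point, the base point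
  \<open>s w\<close> may move with \<open>w\<close>.\<close>

lemma tendsto_shift:
  assumes U: "F \<noteq> bot" and \<phi>: "posdef \<phi>" and lim: "((\<lambda>w. \<phi> (r w)) \<longlongrightarrow> \<phi> 0) F"
  shows "((\<lambda>w. \<phi> (s w + r w) - \<phi> (s w)) \<longlongrightarrow> 0) F"
proof -
  have "((\<lambda>w. sqrt (2 * \<phi> 0 * (\<phi> 0 - \<phi> (r w)))) \<longlongrightarrow> sqrt (2 * \<phi> 0 * (\<phi> 0 - \<phi> 0))) F"
    by (intro tendsto_intros lim)
  then have "((\<lambda>w. sqrt (2 * \<phi> 0 * (\<phi> 0 - \<phi> (r w)))) \<longlongrightarrow> 0) F" by simp
  then show ?thesis
    by (rule tendsto_rabs_zero_cancel[OF tendsto_sandwich[of "\<lambda>_. 0", OF _ _ tendsto_const], rotated 2])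
      (auto intro!: always_eventually real_le_rsqrt simp: posdef_Krein[OF \<phi>])
qed

text \<open>Weak convergence without loss of norm is norm convergence, so the value at
  \<open>0\<close> decides the limits at all \<open>x\<close>.\<close>

lemma qlim_eq_self_iff:
  assumes U: "ultrafilter U" and \<phi>: "posdef \<phi>"
  shows "qlim U q \<phi> = \<phi> \<longleftrightarrow> ((\<lambda>w. \<phi> (q w)) \<longlongrightarrow> \<phi> 0) U"
proof
  assume "qlim U q \<phi> = \<phi>"
  then show "((\<lambda>w. \<phi> (q w)) \<longlongrightarrow> \<phi> 0) U"
    using tendsto_qlim[OF U \<phi>, of 0 q] by simp
next
  assume lim: "((\<lambda>w. \<phi> (q w)) \<longlongrightarrow> \<phi> 0) U"
  show "qlim U q \<phi> = \<phi>"
  proof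
    fix x
    have "((\<lambda>w. \<phi> (x + q w) - \<phi> x) \<longlongrightarrow> 0) U"
      by (rule tendsto_shift[OF ultrafilter_nontrivial[OF U] \<phi> lim])
    then have "((\<lambda>w. \<phi> (x + q w)) \<longlongrightarrow> \<phi> x) U" by (simp add: LIM_zero_iff)
    then show "qlim U q \<phi> x = \<phi> x" unfolding qlim_def by (rule ulim_eqI[OF U])
  qed
qed

text \<open>Both \<open>\<psi>\<close> and \<open>\<phi> - \<psi>\<close> are largest at
  \<open>0\<close>, so \<open>\<psi> 0 - \<psi> z\<close> lies between \<open>0\<close> and
  \<open>\<phi> 0 - \<phi> z\<close>.\<close>

lemma qlim_eq_self_mono:
  assumes U: "ultrafilter U" and \<phi>: "posdef \<phi>" "posdef \<psi>" "posdef (\<lambda>x. \<phi> x - \<psi> x)"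
    and "qlim U q \<phi> = \<phi>"
  shows "qlim U q \<psi> = \<psi>"
proof -
  have "((\<lambda>w. \<phi> 0 - \<phi> (q w)) \<longlongrightarrow> \<phi> 0 - \<phi> 0) U"
    using assms by (intro tendsto_intros) (simp flip: qlim_eq_self_iff)
  moreover have "0 \<le> \<psi> 0 - \<psi> z" "\<psi> 0 - \<psi> z \<le> \<phi> 0 - \<phi> z" for z
    using posdef_abs_le[OF \<phi>(2), of z] posdef_abs_le[OF \<phi>(3), of z] by auto
  ultimately have "((\<lambda>w. \<psi> 0 - \<psi> (q w)) \<longlongrightarrow> 0) U"
    by (intro tendsto_sandwich[of "\<lambda>_. 0" "\<lambda>w. \<psi> 0 - \<psi> (q w)" U "\<lambda>w. \<phi> 0 - \<phi> (q w)"]) auto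
  then have "((\<lambda>w. \<psi> 0 - (\<psi> 0 - \<psi> (q w))) \<longlongrightarrow> \<psi> 0 - 0) U" by (intro tendsto_intros)
  then show ?thesis using qlim_eq_self_iff[OF U \<phi>(2)] by simp
qed

text \<open>The traces of an orthogonal projection on positive definite functions: a splitting into
  two positive definite parts, and idempotence.\<close>

definition projects :: "'v filter \<Rightarrow> ('v \<Rightarrow> 'g::ab_group_add) \<Rightarrow> bool" where
  "projects U q \<longleftrightarrow> (\<forall>\<phi>. posdef \<phi> \<longrightarrow> posdef (qlim U q \<phi>) \<and>
     posdef (\<lambda>x. \<phi> x - qlim U q \<phi> x) \<and> qlim U q (qlim U q \<phi>) = qlim U q \<phi>)"

definition fixset :: "('v filter \<times> ('v \<Rightarrow> 'g::ab_group_add)) set \<Rightarrow> ('g \<Rightarrow> real) \<Rightarrow> ('v filter \<times> ('v \<Rightarrow> 'g)) set" where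
  "fixset J \<phi> = {(U, q) \<in> J. qlim U q \<phi> = \<phi>}"

definition pure :: "('v filter \<times> ('v \<Rightarrow> 'g::ab_group_add)) set \<Rightarrow> ('g \<Rightarrow> real) \<Rightarrow> bool" where
  "pure J \<phi> \<longleftrightarrow> posdef \<phi> \<and> (\<forall>(U, q)\<in>J. qlim U q \<phi> = \<phi> \<or> qlim U q \<phi> = (\<lambda>_. 0))"

text \<open>
  In spectral terms the limit operators are multiplications by indicator functions; splitting
  along them decomposes \<open>\<phi>\<close> into parts on which each of them is constant. The ascending chain
  condition makes the splitting terminate.
\<close>

theorem pure_induction:
  fixes J :: "('v filter \<times> ('v \<Rightarrow> 'g::ab_group_add)) set" and S :: "('g \<Rightarrow> real) \<Rightarrow> real"
  assumes J: "\<And>U q. (U, q) \<in> J \<Longrightarrow> ultrafilter U" "\<And>U q. (U, q) \<in> J \<Longrightarrow> projects U q"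
    and acc: "wf {(fixset J \<psi>, fixset J \<phi>) | \<phi> \<psi>. posdef \<phi> \<and> posdef \<psi> \<and> fixset J \<phi> \<subset> fixset J \<psi>}"
    and add: "\<And>\<phi> \<psi>. posdef \<phi> \<Longrightarrow> posdef \<psi> \<Longrightarrow> S (\<lambda>x. \<phi> x + \<psi> x) \<le> S \<phi> + S \<psi>"
    and bound: "\<And>\<phi>. posdef \<phi> \<Longrightarrow> S \<phi> \<le> C * \<phi> 0"
    and pure: "\<And>\<phi>. pure J \<phi> \<Longrightarrow> S \<phi> \<le> 0"
  shows "posdef \<phi> \<Longrightarrow> S \<phi> \<le> 0"
proof -
  \<comment> \<open>Well-founded induction on the set of operators fixing \<phi>, larger sets coming
    first.\<close>
  have main: "\<forall>\<phi>. posdef \<phi> \<longrightarrow> fixset J \<phi> = \<Gamma> \<longrightarrow> S \<phi> \<le> 0" for \<Gamma>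
    using acc
  proof (induction \<Gamma> rule: wf_induct_rule)
    case (less \<Gamma>)
    show ?case
    proof (intro allI impI)
      fix \<phi> :: "'g \<Rightarrow> real"
      assume \<phi>: "posdef \<phi>" and \<Gamma>: "fixset J \<phi> = \<Gamma>"
      have IH: "S \<psi> \<le> 0" if "posdef \<psi>" "\<Gamma> \<subset> fixset J \<psi>" for \<psi>
        using less.IH[of "fixset J \<psi>"] that \<phi> \<Gamma> by blast
      define N where "N j = qlim (fst j) (snd j)" for j :: "'v filter \<times> ('v \<Rightarrow> 'g)"
      have N: "posdef (N j \<psi>)" "posdef (\<lambda>x. \<psi> x - N j \<psi> x)" "N j (N j \<psi>) = N j \<psi>"
        if "j \<in> J" "posdef \<psi>" for j \<psi>
        using J(2)[of "fst j" "snd j"] that by (auto simp: N_def projects_def)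
      have fix_iff: "j \<in> fixset J \<psi> \<longleftrightarrow> j \<in> J \<and> N j \<psi> = \<psi>" for j \<psi>
        by (cases j) (auto simp: fixset_def N_def)
      have mono: "fixset J \<psi> \<subseteq> fixset J \<chi>" if "posdef \<psi>" "posdef \<chi>" "posdef (\<lambda>x. \<psi> x - \<chi> x)" for \<psi> \<chi>
        using qlim_eq_self_mono[OF J(1) that] by (auto simp: fixset_def)
      have N_le: "N j \<chi> 0 \<le> N j \<psi> 0"
        if "j \<in> J" "posdef \<psi>" "posdef \<chi>" "posdef (\<lambda>x. \<psi> x - \<chi> x)" for j \<psi> \<chi>
      proof -
        have "N j (\<lambda>x. \<chi> x + (\<psi> x - \<chi> x)) = (\<lambda>x. N j \<chi> x + N j (\<lambda>x. \<psi> x - \<chi> x) x)"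
          unfolding N_def using that J(1)[of "fst j" "snd j"] by (intro qlim_add) auto
        then have "N j \<psi> 0 = N j \<chi> 0 + N j (\<lambda>x. \<psi> x - \<chi> x) 0" by (simp add: fun_eq_iff)
        then show ?thesis using posdef_zero_nonneg[OF N(1)[OF that(1,4)]] by simp
      qed
      show "S \<phi> \<le> 0"
      proof (cases "J \<subseteq> \<Gamma>")
        case True
        then have "pure J \<phi>" using \<phi> \<Gamma> by (auto simp: pure_def fixset_def)
        then show ?thesis by (rule pure)
      next
        case False
        \<comment> \<open>The supremum of the mass \<open>N i \<psi> 0\<close> need not be attained;
          the factor \<open>2\<close> leaves room for a nearly optimal choice.\<close>
        have "\<exists>j\<in>J - \<Gamma>. \<forall>i\<in>J - \<Gamma>. N i \<psi> 0 \<le> 2 * N j \<psi> 0" if \<psi>: "posdef \<psi>" for \<psi>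
        proof (cases "\<exists>j\<in>J - \<Gamma>. N j \<psi> 0 > 0")
          case True
          let ?X = "(\<lambda>j. N j \<psi> 0) ` (J - \<Gamma>)"
          have "N i \<psi> 0 \<le> \<psi> 0" if "i \<in> J" for i
            using abs_qlim_le[OF J(1)[of "fst i" "snd i"] \<psi>, of "snd i" 0] that by (simp add: N_def)
          then have bdd: "bdd_above ?X" by (intro bdd_aboveI[of _ "\<psi> 0"]) auto
          have "Sup ?X > 0" using True cSup_upper[OF _ bdd] by (meson imageI less_le_trans)
          then have "Sup ?X / 2 < Sup ?X" by simp
          then obtain j where j: "j \<in> J - \<Gamma>" "Sup ?X / 2 < N j \<psi> 0"
            using less_cSup_iff[OF _ bdd, of "Sup ?X / 2"] False by blast
          have "N i \<psi> 0 \<le> 2 * N j \<psi> 0" if "i \<in> J - \<Gamma>" for i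
            using cSup_upper[OF imageI[OF that] bdd] j(2) by simp
          with j(1) show ?thesis by blast
        next
          case no: False
          have "N i \<psi> 0 = 0" if "i \<in> J - \<Gamma>" for i
            using no that posdef_zero_nonneg[OF N(1)[OF _ \<psi>]] by (metis DiffD1 order_less_le)
          then show ?thesis using False by auto
        qed
        then obtain j where j: "\<And>\<psi>. posdef \<psi> \<Longrightarrow> j \<psi> \<in> J - \<Gamma>"
          "\<And>\<psi> i. posdef \<psi> \<Longrightarrow> i \<in> J - \<Gamma> \<Longrightarrow> N i \<psi> 0 \<le> 2 * N (j \<psi>) \<psi> 0"
          by metis
        \<comment> \<open>Greedy splitting: each stage removes the part fixed by a nearly optimal
          operator. That part is fixed by an operator outside \<Gamma> as well as by all of
          \<Gamma>, so the induction hypothesis covers it.\<close>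
        define f where "f = rec_nat \<phi> (\<lambda>_ \<psi> x. \<psi> x - N (j \<psi>) \<psi> x)"
        have f0: "f 0 = \<phi>" and fS: "f (Suc n) = (\<lambda>x. f n x - N (j (f n)) (f n) x)" for n
          by (simp_all add: f_def)
        have pf: "posdef (f n)" for n
          by (induction n) (auto simp: f0 fS \<phi> intro!: N(2) j(1)[THEN DiffD1])
        have fix_f: "\<Gamma> \<subseteq> fixset J (f n)" for n
        proof (induction n)
          case (Suc n)
          have "posdef (\<lambda>x. f n x - f (Suc n) x)" using N(1) j(1) pf by (simp add: fS)
          with Suc show ?case using mono[OF pf pf, of n "Suc n"] by blast
        qed (simp add: f0 \<Gamma>)
        have S_f: "S \<phi> \<le> S (f n)" for n
        proof (induction n)
          case (Suc n)
          let ?\<psi> = "N (j (f n)) (f n)"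
          have pd: "posdef ?\<psi>" using N(1) j(1) pf by blast
          have "fixset J (f n) \<subseteq> fixset J ?\<psi>"
            by (rule mono) (use pd pf N(2) j(1) in blast)+
          moreover have "j (f n) \<in> fixset J ?\<psi>" using N(3) j(1) pf fix_iff by blast
          moreover have "j (f n) \<notin> \<Gamma>" using j(1) pf by blast
          ultimately have "S ?\<psi> \<le> 0" using fix_f[of n] by (intro IH pd) blast
          moreover have "S (f n) \<le> S ?\<psi> + S (f (Suc n))"
            using add[OF pd pf[of "Suc n"]] by (simp add: fS)
          ultimately show ?case using Suc by simp
        qed (simp add: f0)
        have diff: "posdef (\<lambda>x. f n x - f (n + k) x)" for n k
        proof (induction k)
          case 0
          show ?case by (simp add: posdef_def)
        next
          case (Suc k)
          have "posdef (\<lambda>x. N (j (f (n + k))) (f (n + k)) x)" using N(1) j(1) pf by simp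
          from posdef_add[OF Suc this] show ?case by (simp add: fS algebra_simps)
        qed
        \<comment> \<open>As \<open>f n - f (n + k)\<close> is positive definite, convergence at
          \<open>0\<close> controls convergence at every point.\<close>
        have "decseq (\<lambda>n. f n 0)"
          using posdef_zero_nonneg[OF diff] by (auto simp: decseq_def le_iff_add)
        then obtain l where l: "(\<lambda>n. f n 0) \<longlonglongrightarrow> l"
          using decseq_convergent[of "\<lambda>n. f n 0" 0] posdef_zero_nonneg[OF pf] by blast
        have "Cauchy (\<lambda>n. f n x)" for x
          unfolding Cauchy_altdef2
        proof (intro allI impI)
          fix e :: real assume "e > 0"
          then obtain n0 where n0: "\<And>n. n \<ge> n0 \<Longrightarrow> \<bar>f n 0 - f n0 0\<bar> < e"
            using LIMSEQ_imp_Cauchy[OF l] unfolding Cauchy_altdef2 by (auto simp: dist_real_def)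
          have "\<bar>f n x - f n0 x\<bar> < e" if "n \<ge> n0" for n
            using posdef_abs_le[OF diff[of n0 "n - n0"], of x] n0[OF that] that by simp
          then show "\<exists>N. \<forall>n\<ge>N. dist (f n x) (f N x) < e" by (auto simp: dist_real_def)
        qed
        then have "\<forall>x. \<exists>a. (\<lambda>n. f n x) \<longlonglongrightarrow> a"
          using Cauchy_convergent convergent_def by blast
        then obtain g where g: "\<And>x. (\<lambda>n. f n x) \<longlonglongrightarrow> g x" by metis
        have pg: "posdef g"
          by (rule posdef_limit[OF _ _ g]) (simp_all add: pf)
        have dg: "posdef (\<lambda>x. f n x - g x)" for n
        proof (rule posdef_limit[of sequentially "\<lambda>k x. f n x - f (n + k) x"])
          show "(\<lambda>k. f n x - f (n + k) x) \<longlonglongrightarrow> f n x - g x" for x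
            using LIMSEQ_ignore_initial_segment[OF g, of n x] by (intro tendsto_intros) (simp add: add.commute)
        qed (simp_all add: diff)
        have "pure J g"
          unfolding pure_def
        proof (intro conjI pg ballI, clarify)
          fix U q assume Uq: "(U, q) \<in> J" and ne: "qlim U q g \<noteq> (\<lambda>_. 0)"
          show "qlim U q g = g"
          proof (cases "(U, q) \<in> \<Gamma>")
            case True
            then have "(U, q) \<in> fixset J g" using mono[OF pf pg dg, of 0] f0 \<Gamma> by auto
            then show ?thesis by (simp add: fixset_def)
          next
            case False
            \<comment> \<open>What an operator outside \<Gamma> keeps of the limit \<open>g\<close>
              is at most twice the mass removed at stage \<open>n\<close>, and this tends to
              \<open>0\<close>.\<close>
            have "N (U, q) g 0 \<le> 2 * (f n 0 - f (Suc n) 0)" for n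
            proof -
              have "N (U, q) g 0 \<le> N (U, q) (f n) 0" by (rule N_le[OF Uq pf pg dg])
              also have "\<dots> \<le> 2 * N (j (f n)) (f n) 0" using j(2)[OF pf] False Uq by simp
              finally show ?thesis by (simp add: fS)
            qed
            moreover have "(\<lambda>n. 2 * (f n 0 - f (Suc n) 0)) \<longlonglongrightarrow> 2 * (l - l)"
              by (intro tendsto_intros l LIMSEQ_Suc)
            ultimately have "N (U, q) g 0 \<le> 0" by (intro LIMSEQ_le_const) auto
            then have "N (U, q) g = (\<lambda>_. 0)" using posdef_eq_0 N(1) Uq pg by blast
            with ne show ?thesis by (simp add: N_def)
          qed
        qed
        then have "S g \<le> 0" by (rule pure)
        have "S \<phi> \<le> C * (f n 0 - g 0)" for n
        proof -
          have "S (f n) \<le> S g + S (\<lambda>x. f n x - g x)" using add[OF pg dg] by simp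
          then show ?thesis using \<open>S g \<le> 0\<close> bound[OF dg, of n] S_f[of n] by simp
        qed
        moreover have "(\<lambda>n. C * (f n 0 - g 0)) \<longlonglongrightarrow> C * (g 0 - g 0)" by (intro tendsto_intros g)
        ultimately show ?thesis by (intro LIMSEQ_le_const) auto
      qed
    qed
  qed
  then show "posdef \<phi> \<Longrightarrow> S \<phi> \<le> 0" by blast
qed

section \<open>Limits of polynomial translates along idempotent ultrafilters\<close>

lemma idempotentD:
  "idempotent_ultrafilter f U \<Longrightarrow> \<forall>\<^sub>F x in U. P x \<Longrightarrow> \<forall>\<^sub>F x in U. \<forall>\<^sub>F y in U. P (f x y)"
  by (simp add: idempotent_ultrafilter_def)

lemma idempotent_ultra: "idempotent_ultrafilter f U \<Longrightarrow> ultrafilter U"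
  by (simp add: idempotent_ultrafilter_def)

text \<open>The points are the suffix sums of one sequence: for \<open>i < j\<close> one has
  \<open>x i = a + x j\<close> with \<open>a\<close> the sum of the terms in between, the situation
  that \<open>R\<close> describes.\<close>

lemma suffix_selection:
  fixes U :: "'v::ab_group_add filter"
  assumes U: "idempotent_ultrafilter (+) U" and R: "\<forall>\<^sub>F a in U. \<forall>\<^sub>F b in U. R (a + b) b"
  shows "\<exists>x::nat \<Rightarrow> 'v. \<forall>j<n. \<forall>i<j. R (x i) (x j)"
proof -
  \<comment> \<open>\<open>c i\<close> sums the terms chosen so far from position \<open>i\<close>
    on, and \<open>b\<close> is the tail yet to come. The last clause is what makes the next choice
    possible.\<close>
  have "\<exists>c::nat \<Rightarrow> 'v. c n = 0 \<and> (\<forall>\<^sub>F b in U. \<forall>j\<le>n. \<forall>i<j. R (c i + b) (c j + b)) \<and>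
    (\<forall>i\<le>n. \<forall>\<^sub>F v in U. \<forall>\<^sub>F b in U. R (c i + v + b) b)"
  proof (induction n)
    case 0
    show ?case by (rule exI[of _ "\<lambda>_. 0"]) (simp add: R)
  next
    case (Suc n)
    then obtain c where c: "c n = 0" "\<forall>\<^sub>F b in U. \<forall>j\<le>n. \<forall>i<j. R (c i + b) (c j + b)"
      "\<And>i. i \<le> n \<Longrightarrow> \<forall>\<^sub>F v in U. \<forall>\<^sub>F b in U. R (c i + v + b) b" by blast
    have "\<forall>\<^sub>F v in U. \<forall>\<^sub>F b in U. \<forall>j\<le>n. \<forall>i<j. R (c i + (v + b)) (c j + (v + b))"
      by (rule idempotentD[OF U c(2)])
    moreover have "\<forall>\<^sub>F v in U. \<forall>i\<in>{..n}. \<forall>\<^sub>F b in U. R (c i + v + b) b"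
      using c(3) by (intro eventually_ball_finite) auto
    moreover have "\<forall>\<^sub>F v in U. \<forall>i\<in>{..n}. \<forall>\<^sub>F v' in U. \<forall>\<^sub>F b in U. R (c i + (v + v') + b) b"
      using idempotentD[OF U c(3)] by (intro eventually_ball_finite) auto
    ultimately have "\<exists>v. (\<forall>\<^sub>F b in U. \<forall>j\<le>n. \<forall>i<j. R (c i + (v + b)) (c j + (v + b))) \<and>
      (\<forall>i\<in>{..n}. \<forall>\<^sub>F b in U. R (c i + v + b) b) \<and>
      (\<forall>i\<in>{..n}. \<forall>\<^sub>F v' in U. \<forall>\<^sub>F b in U. R (c i + (v + v') + b) b)"
      using ultrafilter_nontrivial[OF idempotent_ultra[OF U]]
      by (intro eventually_happens'[of U] eventually_conj)
    then obtain v where v: "\<forall>\<^sub>F b in U. \<forall>j\<le>n. \<forall>i<j. R (c i + (v + b)) (c j + (v + b))"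
      "\<forall>i\<in>{..n}. \<forall>\<^sub>F b in U. R (c i + v + b) b"
      "\<And>i. i \<le> n \<Longrightarrow> \<forall>\<^sub>F v' in U. \<forall>\<^sub>F b in U. R (c i + (v + v') + b) b" by auto
    have v2: "\<forall>\<^sub>F b in U. \<forall>i\<in>{..n}. R (c i + v + b) b"
      using v(2) by (intro eventually_ball_finite) auto
    let ?c = "\<lambda>i. if i \<le> n then c i + v else 0"
    have "\<forall>\<^sub>F b in U. \<forall>j\<le>Suc n. \<forall>i<j. R (?c i + b) (?c j + b)"
      using v(1) v2 by eventually_elim (auto simp: le_Suc_eq add.assoc)
    moreover have "\<forall>i\<le>Suc n. \<forall>\<^sub>F v' in U. \<forall>\<^sub>F b in U. R (?c i + v' + b) b"
      using v(3) R by (auto simp: add.assoc le_Suc_eq)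
    ultimately show ?case by (intro exI[of _ ?c]) simp
  qed
  then obtain c :: "nat \<Rightarrow> 'v" where "\<forall>\<^sub>F b in U. \<forall>j\<le>n. \<forall>i<j. R (c i + b) (c j + b)" by blast
  then obtain b where "\<forall>j\<le>n. \<forall>i<j. R (c i + b) (c j + b)"
    using ultrafilter_nontrivial[OF idempotent_ultra[OF U]] eventually_happens' by blast
  then show ?thesis by (intro exI[of _ "\<lambda>i. c i + b"]) auto
qed

text \<open>Comparison with the kernel that is exactly \<open>L\<close> off the diagonal and
  \<open>D\<close> on it. With \<open>n\<close> weights \<open>1/n\<close> and \<epsilon> tending to
  \<open>0\<close>, only the first term survives for large \<open>n\<close>.\<close>

lemma quadratic_form_le:
  fixes a :: "'i \<Rightarrow> real"
  assumes "finite I" and \<epsilon>: "\<epsilon> \<ge> 0"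
    and off: "\<And>i j. i \<in> I \<Longrightarrow> j \<in> I \<Longrightarrow> i \<noteq> j \<Longrightarrow> \<bar>k i j - L\<bar> \<le> \<epsilon>"
    and diag: "\<And>i. i \<in> I \<Longrightarrow> k i i = D"
  shows "(\<Sum>i\<in>I. \<Sum>j\<in>I. a i * a j * k i j) \<le>
    L * (\<Sum>i\<in>I. a i)\<^sup>2 + (D - L) * (\<Sum>i\<in>I. (a i)\<^sup>2) + \<epsilon> * (\<Sum>i\<in>I. \<bar>a i\<bar>)\<^sup>2"
proof -
  have "a i * a j * k i j \<le> L * (a i * a j) + (if i = j then (D - L) * (a i)\<^sup>2 else 0) + \<epsilon> * (\<bar>a i\<bar> * \<bar>a j\<bar>)"
    if "i \<in> I" "j \<in> I" for i j
  proof (cases "i = j")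
    case True
    then show ?thesis using diag[OF that(1)] \<epsilon> by (simp add: algebra_simps power2_eq_square)
  next
    case False
    have "a i * a j * (k i j - L) \<le> \<bar>a i * a j * (k i j - L)\<bar>" by simp
    also have "\<dots> \<le> \<bar>a i\<bar> * \<bar>a j\<bar> * \<epsilon>"
      unfolding abs_mult using off[OF that False] by (intro mult_left_mono) auto
    finally show ?thesis using False by (simp add: algebra_simps)
  qed
  then have "(\<Sum>i\<in>I. \<Sum>j\<in>I. a i * a j * k i j) \<le>
    (\<Sum>i\<in>I. \<Sum>j\<in>I. L * (a i * a j) + (if i = j then (D - L) * (a i)\<^sup>2 else 0) + \<epsilon> * (\<bar>a i\<bar> * \<bar>a j\<bar>))"
    by (intro sum_mono)
  also have "\<dots> = L * (\<Sum>i\<in>I. a i)\<^sup>2 + (D - L) * (\<Sum>i\<in>I. (a i)\<^sup>2) + \<epsilon> * (\<Sum>i\<in>I. \<bar>a i\<bar>)\<^sup>2"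
    using \<open>finite I\<close>
    by (simp add: sum.distrib power2_eq_square[of "sum _ _"] sum_product flip: sum_distrib_left)
  finally show ?thesis .
qed

text \<open>The difference of \<open>q\<close> in direction \<open>v\<close>, normalised to vanish
  at \<open>0\<close> when \<open>q 0 = 0\<close>; it measures the failure of additivity.\<close>

definition pdiff :: "('v::ab_group_add \<Rightarrow> 'g::ab_group_add) \<Rightarrow> 'v \<Rightarrow> 'v \<Rightarrow> 'g" where
  "pdiff q v w = q (v + w) - q v - q w"

text \<open>Along a suffix sequence the vectors \<open>T^(q y) f\<close> are almost orthogonal, so
  their average is short; yet its inner product with a fixed vector stays near the limit, which must
  be \<open>0\<close>.\<close>

lemma van_der_Corput:
  fixes U :: "'v::ab_group_add filter"
  assumes U: "idempotent_ultrafilter (+) U" and \<phi>: "posdef \<phi>"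
    and lim: "\<And>\<epsilon>. \<epsilon> > 0 \<Longrightarrow> \<forall>\<^sub>F a in U. \<forall>\<^sub>F b in U. \<bar>\<phi> (q (a + b) - q b)\<bar> < \<epsilon>"
  shows "qlim U q \<phi> x = 0"
proof -
  note ultra = idempotent_ultra[OF U]
  define l where "l = qlim U q \<phi> x"
  have "\<exists>s. \<bar>s - l\<bar> \<le> inverse (real (Suc N)) \<and> s\<^sup>2 \<le> \<phi> 0 * ((\<phi> 0 + 1) * inverse (real (Suc N)))" for N
  proof -
    define \<epsilon> where "\<epsilon> = inverse (real (Suc N))"
    have \<epsilon>: "\<epsilon> > 0" by (simp add: \<epsilon>_def)
    have N\<epsilon>: "(1 + real N) * (\<epsilon> * c) = c" "(1 + real N) * \<epsilon> = 1" for c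
      by (simp_all add: \<epsilon>_def field_simps)
    let ?R = "\<lambda>a b. \<bar>\<phi> (q a - q b)\<bar> < \<epsilon> \<and> \<bar>\<phi> (x + q a) - l\<bar> < \<epsilon>"
    have "\<forall>\<^sub>F a in U. \<bar>\<phi> (x + q a) - l\<bar> < \<epsilon>"
      using tendstoD[OF tendsto_qlim[OF ultra \<phi>] \<epsilon>] by (simp add: dist_real_def l_def)
    then have "\<forall>\<^sub>F a in U. \<forall>\<^sub>F b in U. \<bar>\<phi> (x + q (a + b)) - l\<bar> < \<epsilon>"
      by (rule idempotentD[OF U])
    with lim[OF \<epsilon>] have "\<forall>\<^sub>F a in U. \<forall>\<^sub>F b in U. ?R (a + b) b"
      by eventually_elim (rule eventually_conj)
    \<comment> \<open>\<open>?R\<close> compares only its first argument with \<open>l\<close>, so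
      one point beyond the \<open>N + 1\<close> averaged ones is selected. \<epsilon> is both their
      weight and the tolerance.\<close>
    then obtain y where y: "\<And>i j. i < j \<Longrightarrow> j < Suc (Suc N) \<Longrightarrow> ?R (y i) (y j)"
      using suffix_selection[OF U, of ?R "Suc (Suc N)"] by blast
    let ?s = "\<Sum>i<Suc N. \<epsilon> * \<phi> (x + q (y i) - 0)"
    have "?s - l = (\<Sum>i<Suc N. \<epsilon> * (\<phi> (x + q (y i)) - l))"
      by (simp add: right_diff_distrib sum_subtractf N\<epsilon> del: sum.lessThan_Suc)
    also have "\<bar>\<dots>\<bar> \<le> (\<Sum>i<Suc N. \<epsilon> * \<epsilon>)"
      using y[of _ "Suc N"] \<epsilon> by (intro order_trans[OF sum_abs] sum_mono) (auto simp: abs_mult less_imp_le)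
    finally have 1: "\<bar>?s - l\<bar> \<le> \<epsilon>" by (simp add: N\<epsilon> del: sum.lessThan_Suc)
    have off: "\<bar>\<phi> (x + q (y i) - (x + q (y j))) - 0\<bar> \<le> \<epsilon>"
      if "i \<in> {..<Suc N}" "j \<in> {..<Suc N}" "i \<noteq> j" for i j
      using that y[of i j] y[of j i] posdef_minus_commute[OF \<phi>, of "q (y i)" "q (y j)"]
      by (cases "i < j") auto
    have "?s\<^sup>2 \<le> \<phi> 0 * (\<Sum>i<Suc N. \<Sum>j<Suc N. \<epsilon> * \<epsilon> * \<phi> (x + q (y i) - (x + q (y j))))"
      by (rule posdef_Cauchy_Schwarz[OF \<phi>]) simp
    also have "\<dots> \<le> \<phi> 0 * (0 * (\<Sum>i<Suc N. \<epsilon>)\<^sup>2 + (\<phi> 0 - 0) * (\<Sum>i<Suc N. \<epsilon>\<^sup>2) + \<epsilon> * (\<Sum>i<Suc N. \<bar>\<epsilon>\<bar>)\<^sup>2)"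
      using off \<epsilon> by (intro mult_left_mono quadratic_form_le posdef_zero_nonneg[OF \<phi>]) auto
    also have "\<dots> = \<phi> 0 * ((\<phi> 0 + 1) * \<epsilon>)"
      using \<epsilon> by (simp add: power2_eq_square N\<epsilon> del: sum.lessThan_Suc) (simp add: algebra_simps)?
    finally have 2: "?s\<^sup>2 \<le> \<phi> 0 * ((\<phi> 0 + 1) * \<epsilon>)" .
    show ?thesis using 1 2 unfolding \<epsilon>_def by blast
  qed
  then obtain s where s: "\<And>N. \<bar>s N - l\<bar> \<le> inverse (real (Suc N))"
    "\<And>N. (s N)\<^sup>2 \<le> \<phi> 0 * ((\<phi> 0 + 1) * inverse (real (Suc N)))" by metis
  have "(\<lambda>N. s N - l) \<longlonglongrightarrow> 0"
    by (rule tendsto_rabs_zero_cancel, rule tendsto_sandwich[OF _ _ tendsto_const LIMSEQ_inverse_real_of_nat])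
      (use s(1) in auto)
  then have "s \<longlonglongrightarrow> l" by (simp add: LIM_zero_iff)
  then have "(\<lambda>N. (s N)\<^sup>2) \<longlonglongrightarrow> l\<^sup>2" by (intro tendsto_intros)
  moreover have "(\<lambda>N. \<phi> 0 * ((\<phi> 0 + 1) * inverse (real (Suc N)))) \<longlonglongrightarrow> \<phi> 0 * ((\<phi> 0 + 1) * 0)"
    by (intro tendsto_intros LIMSEQ_inverse_real_of_nat)
  ultimately have "l\<^sup>2 \<le> \<phi> 0 * ((\<phi> 0 + 1) * 0)"
    using s(2) by (intro LIMSEQ_le) auto
  then show ?thesis by (simp add: l_def)
qed

text \<open>The average of many vectors with pairwise inner products near \<open>l\<close> has
  squared norm near \<open>l\<close>.\<close>

lemma suffix_limit_nonneg:
  fixes U :: "'v::ab_group_add filter"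
  assumes U: "idempotent_ultrafilter (+) U" and \<phi>: "posdef \<phi>"
    and lim: "\<And>\<epsilon>. \<epsilon> > 0 \<Longrightarrow> \<forall>\<^sub>F a in U. \<forall>\<^sub>F b in U. \<bar>\<phi> (q (a + b) - q b) - l\<bar> < \<epsilon>"
  shows "0 \<le> l"
proof -
  have "0 \<le> l + (\<phi> 0 - l + 1) * inverse (real (Suc N))" for N
  proof -
    define \<epsilon> where "\<epsilon> = inverse (real (Suc N))"
    have \<epsilon>: "\<epsilon> > 0" by (simp add: \<epsilon>_def)
    have N\<epsilon>: "(1 + real N) * (\<epsilon> * c) = c" "(1 + real N) * \<epsilon> = 1" for c
      by (simp_all add: \<epsilon>_def field_simps)
    obtain y where y: "\<And>i j. i < j \<Longrightarrow> j < Suc N \<Longrightarrow> \<bar>\<phi> (q (y i) - q (y j)) - l\<bar> < \<epsilon>"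
      using suffix_selection[OF U, of "\<lambda>a b. \<bar>\<phi> (q a - q b) - l\<bar> < \<epsilon>" "Suc N"] lim[OF \<epsilon>] by blast
    have off: "\<bar>\<phi> (q (y i) - q (y j)) - l\<bar> \<le> \<epsilon>"
      if "i \<in> {..<Suc N}" "j \<in> {..<Suc N}" "i \<noteq> j" for i j
      using that y[of i j] y[of j i] posdef_minus_commute[OF \<phi>, of "q (y i)" "q (y j)"]
      by (cases "i < j") auto
    have "0 \<le> (\<Sum>i<Suc N. \<Sum>j<Suc N. \<epsilon> * \<epsilon> * \<phi> (q (y i) - q (y j)))"
      by (rule posdef_sum[OF \<phi>]) simp
    also have "\<dots> \<le> l * (\<Sum>i<Suc N. \<epsilon>)\<^sup>2 + (\<phi> 0 - l) * (\<Sum>i<Suc N. \<epsilon>\<^sup>2) + \<epsilon> * (\<Sum>i<Suc N. \<bar>\<epsilon>\<bar>)\<^sup>2"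
      using off \<epsilon> by (intro quadratic_form_le) auto
    also have "\<dots> = l + (\<phi> 0 - l + 1) * \<epsilon>"
      using \<epsilon> by (simp add: power2_eq_square N\<epsilon> del: sum.lessThan_Suc) (simp add: algebra_simps)?
    finally show ?thesis by (simp add: \<epsilon>_def)
  qed
  moreover have "(\<lambda>N. l + (\<phi> 0 - l + 1) * inverse (real (Suc N))) \<longlonglongrightarrow> l + (\<phi> 0 - l + 1) * 0"
    by (intro tendsto_intros LIMSEQ_inverse_real_of_nat)
  ultimately show ?thesis using LIMSEQ_le_const by fastforce
qed

text \<open>
  Symmetry holds because the averages of \<open>T\<^sup>q\<^sup>(\<^sup>y\<^sup>)f\<close> over an early and over a late block of a
  suffix sequence are close in norm, and so have nearly the same inner product with a vector
  in between.
\<close>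

lemma suffix_limit_symmetric:
  fixes U :: "'v::ab_group_add filter"
  assumes U: "idempotent_ultrafilter (+) U" and \<phi>: "posdef \<phi>"
    and lim: "\<And>z \<epsilon>. \<epsilon> > 0 \<Longrightarrow> \<forall>\<^sub>F a in U. \<forall>\<^sub>F b in U. \<bar>\<phi> (z + q (a + b) - q b) - l z\<bar> < \<epsilon>"
  shows "l (- z) = l z"
proof -
  have "\<exists>s. \<bar>s - (l z - l (- z))\<bar> \<le> 2 * inverse (real (Suc N)) \<and>
      s\<^sup>2 \<le> \<phi> 0 * ((2 * (\<phi> 0 - l 0) + 4) * inverse (real (Suc N)))" for N
  proof -
    define \<epsilon> where "\<epsilon> = inverse (real (Suc N))"
    have \<epsilon>: "\<epsilon> > 0" by (simp add: \<epsilon>_def)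
    have N\<epsilon>: "(1 + real N) * (\<epsilon> * c) = c" "(1 + real N) * \<epsilon> = 1" for c
      by (simp_all add: \<epsilon>_def field_simps)
    let ?R = "\<lambda>a b. \<bar>\<phi> (0 + q a - q b) - l 0\<bar> < \<epsilon> \<and> \<bar>\<phi> (z + q a - q b) - l z\<bar> < \<epsilon> \<and>
      \<bar>\<phi> (- z + q a - q b) - l (- z)\<bar> < \<epsilon>"
    let ?n = "Suc N + Suc (Suc N)"
    have "\<forall>\<^sub>F a in U. \<forall>\<^sub>F b in U. ?R (a + b) b"
      using lim[OF \<epsilon>, of 0] lim[OF \<epsilon>, of z] lim[OF \<epsilon>, of "- z"]
      by eventually_elim (intro eventually_conj)
    then obtain y where y: "\<And>i j. i < j \<Longrightarrow> j < ?n \<Longrightarrow> ?R (y i) (y j)"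
      using suffix_selection[OF U, of ?R ?n] by blast
    let ?I = "(UNIV :: bool set) \<times> {..<Suc N}"
    \<comment> \<open>\<open>True\<close> marks the early block, up to index \<open>N\<close>, and
      \<open>False\<close> the late one, from \<open>Suc (Suc N)\<close> on; \<open>Suc N\<close>
      lies in between. The weights \<open>c\<close> form the difference of the two averages.\<close>
    define x where "x p = (if fst p then q (y (snd p)) else q (y (Suc (Suc N) + snd p)))" for p :: "bool \<times> nat"
    define c where "c p = (if fst p then \<epsilon> else - \<epsilon>)" for p :: "bool \<times> nat"
    have sum_I: "(\<Sum>p\<in>?I. h p) = (\<Sum>i<Suc N. h (True, i)) + (\<Sum>i<Suc N. h (False, i))" for h :: "_ \<Rightarrow> real"
    proof -
      have "(\<Sum>p\<in>?I. h p) = (\<Sum>b\<in>UNIV. \<Sum>i<Suc N. h (b, i))"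
        by (simp add: sum.cartesian_product del: sum.lessThan_Suc)
      then show ?thesis by (simp add: UNIV_bool del: sum.lessThan_Suc)
    qed
    \<comment> \<open>The shifted middle point gives \<open>l z\<close> against early points and, by
      the symmetry of \<phi>, \<open>l (- z)\<close> against late ones.\<close>
    define m where "m = q (y (Suc N)) - z"
    let ?s = "\<Sum>p\<in>?I. c p * \<phi> (x p - m)"
    have early: "\<bar>\<phi> (x (True, i) - m) - l z\<bar> \<le> \<epsilon>" if "i < Suc N" for i
      using y[of i "Suc N"] that by (auto simp: x_def m_def algebra_simps)
    have late: "\<bar>\<phi> (x (False, i) - m) - l (- z)\<bar> \<le> \<epsilon>" if "i < Suc N" for i
      using y[of "Suc N" "Suc (Suc N) + i"] that posdef_minus_commute[OF \<phi>, of m "x (False, i)"]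
      by (auto simp: x_def m_def algebra_simps)
    have "?s - (l z - l (- z)) = (\<Sum>i<Suc N. \<epsilon> * (\<phi> (x (True, i) - m) - l z)) -
        (\<Sum>i<Suc N. \<epsilon> * (\<phi> (x (False, i) - m) - l (- z)))"
      by (simp add: sum_I c_def right_diff_distrib sum_subtractf sum_negf N\<epsilon> del: sum.lessThan_Suc)
    also have "\<bar>\<dots>\<bar> \<le> (\<Sum>i<Suc N. \<epsilon> * \<epsilon>) + (\<Sum>i<Suc N. \<epsilon> * \<epsilon>)"
      using early late \<epsilon>
      by (intro order_trans[OF abs_triangle_ineq4] add_mono order_trans[OF sum_abs] sum_mono)
        (auto simp: abs_mult)
    finally have 1: "\<bar>?s - (l z - l (- z))\<bar> \<le> 2 * \<epsilon>" by (simp add: N\<epsilon> del: sum.lessThan_Suc)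
    have y0: "\<bar>\<phi> (q (y i) - q (y j)) - l 0\<bar> \<le> \<epsilon>" if "i \<noteq> j" "i < ?n" "j < ?n" for i j
      using that y[of i j] y[of j i] posdef_minus_commute[OF \<phi>, of "q (y i)" "q (y j)"]
      by (cases "i < j") auto
    have off: "\<bar>\<phi> (x p - x p') - l 0\<bar> \<le> \<epsilon>" if "p \<in> ?I" "p' \<in> ?I" "p \<noteq> p'" for p p'
      using that unfolding x_def by (cases p; cases p') (auto intro!: y0)
    have "?s\<^sup>2 \<le> \<phi> 0 * (\<Sum>p\<in>?I. \<Sum>p'\<in>?I. c p * c p' * \<phi> (x p - x p'))"
      by (rule posdef_Cauchy_Schwarz[OF \<phi>]) simp
    also have "\<dots> \<le> \<phi> 0 * (l 0 * (\<Sum>p\<in>?I. c p)\<^sup>2 + (\<phi> 0 - l 0) * (\<Sum>p\<in>?I. (c p)\<^sup>2) +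
        \<epsilon> * (\<Sum>p\<in>?I. \<bar>c p\<bar>)\<^sup>2)"
      using off \<epsilon> by (intro mult_left_mono quadratic_form_le posdef_zero_nonneg[OF \<phi>]) auto
    \<comment> \<open>The weights sum to \<open>0\<close>, which removes the \<open>l 0\<close>
      term. The \<open>2\<close> counts the two diagonals and the \<open>4\<close> is the square of
      the total absolute weight.\<close>
    also have "\<dots> = \<phi> 0 * ((2 * (\<phi> 0 - l 0) + 4) * \<epsilon>)"
      unfolding sum_I using \<epsilon>
      by (simp add: c_def power2_eq_square N\<epsilon> sum_negf del: sum.lessThan_Suc) (simp add: algebra_simps)
    finally have 2: "?s\<^sup>2 \<le> \<phi> 0 * ((2 * (\<phi> 0 - l 0) + 4) * \<epsilon>)" .
    show ?thesis using 1 2 unfolding \<epsilon>_def by blast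
  qed
  then obtain s where s: "\<And>N. \<bar>s N - (l z - l (- z))\<bar> \<le> 2 * inverse (real (Suc N))"
    "\<And>N. (s N)\<^sup>2 \<le> \<phi> 0 * ((2 * (\<phi> 0 - l 0) + 4) * inverse (real (Suc N)))" by metis
  have "(\<lambda>N. 2 * inverse (real (Suc N))) \<longlonglongrightarrow> 2 * 0"
    by (intro tendsto_intros LIMSEQ_inverse_real_of_nat)
  then have null: "(\<lambda>N. 2 * inverse (real (Suc N))) \<longlonglongrightarrow> 0" by simp
  have "(\<lambda>N. s N - (l z - l (- z))) \<longlonglongrightarrow> 0"
    by (rule tendsto_rabs_zero_cancel, rule tendsto_sandwich[OF _ _ tendsto_const null])
      (use s(1) in auto)
  then have "s \<longlonglongrightarrow> l z - l (- z)" by (simp add: LIM_zero_iff)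
  then have "(\<lambda>N. (s N)\<^sup>2) \<longlonglongrightarrow> (l z - l (- z))\<^sup>2" by (intro tendsto_intros)
  moreover have "(\<lambda>N. \<phi> 0 * ((2 * (\<phi> 0 - l 0) + 4) * inverse (real (Suc N)))) \<longlonglongrightarrow>
      \<phi> 0 * ((2 * (\<phi> 0 - l 0) + 4) * 0)"
    by (intro tendsto_intros LIMSEQ_inverse_real_of_nat)
  ultimately have "(l z - l (- z))\<^sup>2 \<le> \<phi> 0 * ((2 * (\<phi> 0 - l 0) + 4) * 0)"
    using s(2) by (intro LIMSEQ_le) auto
  then show ?thesis by simp
qed

section \<open>The ascending chain condition\<close>

definition subgrp :: "'g::ab_group_add set \<Rightarrow> bool" where
  "subgrp H \<longleftrightarrow> 0 \<in> H \<and> (\<forall>x\<in>H. \<forall>y\<in>H. x - y \<in> H)"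

definition noeth :: "'g::ab_group_add set \<Rightarrow> bool" where
  "noeth G \<longleftrightarrow> (\<forall>H::nat \<Rightarrow> 'g set. (\<forall>n. subgrp (H n) \<and> H n \<subseteq> G \<and> H n \<subseteq> H (Suc n)) \<longrightarrow>
     (\<exists>N. \<forall>n\<ge>N. H n = H N))"

lemma noeth_subset: "noeth G \<Longrightarrow> G' \<subseteq> G \<Longrightarrow> noeth G'"
  unfolding noeth_def by (meson order_trans)

lemma noethE:
  assumes "noeth G" "\<And>n. subgrp (H n)" "\<And>n. H n \<subseteq> G" "\<And>n. H n \<subseteq> H (Suc n)"
  obtains N where "\<And>n. n \<ge> N \<Longrightarrow> H n = H N"
  using assms unfolding noeth_def by meson

text \<open>If \<open>T^(r w) f\<close> and \<open>T^(s w) f\<close> both tend to \<open>f\<close>,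
  so does \<open>T^(r w - s w) f\<close>: this is \<open>tendsto_shift\<close> with moving base
  point \<open>r w\<close>.\<close>

lemma subgrp_qlim_fix:
  fixes Q :: "('v \<Rightarrow> 'g::ab_group_add) set"
  assumes "ultrafilter U" and \<phi>: "posdef \<phi>" and Q: "subgrp Q"
  shows "subgrp {q \<in> Q. qlim U q \<phi> = \<phi>}"
  unfolding subgrp_def
proof (intro conjI ballI)
  show "0 \<in> {q \<in> Q. qlim U q \<phi> = \<phi>}"
    using Q assms by (simp add: subgrp_def qlim_eq_self_iff)
  fix r s assume "r \<in> {q \<in> Q. qlim U q \<phi> = \<phi>}" "s \<in> {q \<in> Q. qlim U q \<phi> = \<phi>}"
  then have rs: "r - s \<in> Q" "((\<lambda>w. \<phi> (r w)) \<longlongrightarrow> \<phi> 0) U" "((\<lambda>w. \<phi> (- s w)) \<longlongrightarrow> \<phi> 0) U"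
    using Q assms by (auto simp: subgrp_def qlim_eq_self_iff posdef_minus)
  from tendsto_add[OF tendsto_shift[OF ultrafilter_nontrivial[OF assms(1)] \<phi> rs(3), of r] rs(2)]
  have "((\<lambda>w. \<phi> ((r - s) w)) \<longlongrightarrow> \<phi> 0) U" by simp
  then show "r - s \<in> {q \<in> Q. qlim U q \<phi> = \<phi>}"
    using rs(1) assms by (simp add: qlim_eq_self_iff)
qed

text \<open>For each \<open>U\<close> the maps fixing the functions form an ascending sequence of
  subgroups of \<open>Q\<close>, which stabilises; finitely many \<open>U\<close> share a stage
  \<open>M\<close>.\<close>

lemma wf_fixset:
  fixes Q :: "('v \<Rightarrow> 'g::ab_group_add) set"
  assumes "finite \<U>" "\<And>U. U \<in> \<U> \<Longrightarrow> ultrafilter U" and Q: "subgrp Q" "noeth Q"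
  shows "wf {(fixset (\<U> \<times> Q) \<psi>, fixset (\<U> \<times> Q) \<phi>) | \<phi> \<psi>.
    posdef \<phi> \<and> posdef \<psi> \<and> fixset (\<U> \<times> Q) \<phi> \<subset> fixset (\<U> \<times> Q) \<psi>}"
  unfolding wf_iff_no_infinite_down_chain
proof (intro notI, elim exE)
  let ?J = "\<U> \<times> Q"
  fix f assume "\<forall>i. (f (Suc i), f i) \<in> {(fixset ?J \<psi>, fixset ?J \<phi>) | \<phi> \<psi>.
    posdef \<phi> \<and> posdef \<psi> \<and> fixset ?J \<phi> \<subset> fixset ?J \<psi>}"
  then have f: "\<And>i. f i \<subset> f (Suc i)" "\<And>i. \<exists>\<phi>. posdef \<phi> \<and> f i = fixset ?J \<phi>" by blast+
  have "\<exists>N. \<forall>n\<ge>N. {q. (U, q) \<in> f n} = {q. (U, q) \<in> f N}" if "U \<in> \<U>" for U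
  proof -
    have *: "subgrp {q. (U, q) \<in> f n} \<and> {q. (U, q) \<in> f n} \<subseteq> Q" for n
    proof -
      obtain \<phi> where "posdef \<phi>" "f n = fixset ?J \<phi>" using f(2) by blast
      then show ?thesis
        using subgrp_qlim_fix[OF assms(2)[OF that] _ Q(1), of \<phi>] that by (auto simp: fixset_def)
    qed
    show ?thesis
      by (rule noethE[OF Q(2), of "\<lambda>n. {q. (U, q) \<in> f n}"]) (use * f(1) in \<open>blast+\<close>)
  qed
  then obtain N where N: "\<And>U n. U \<in> \<U> \<Longrightarrow> n \<ge> N U \<Longrightarrow> {q. (U, q) \<in> f n} = {q. (U, q) \<in> f (N U)}"
    by metis
  define M where "M = Max (insert 0 (N ` \<U>))"
  have "N U \<le> M" if "U \<in> \<U>" for U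
    unfolding M_def using assms(1) that by (intro Max_ge) auto
  then have "{q. (U, q) \<in> f (Suc M)} = {q. (U, q) \<in> f M}" if "U \<in> \<U>" for U
    using N[OF that, of M] N[OF that, of "Suc M"] that by (simp add: le_SucI)
  moreover have "f (Suc M) \<subseteq> ?J" using f(2)[of "Suc M"] by (auto simp: fixset_def)
  ultimately have "f (Suc M) \<subseteq> f M" by blast
  then show False using f(1)[of M] by blast
qed

section \<open>Polynomial maps and their limit operators\<close>

text \<open>Polynomial maps of degree at most \<open>k\<close> without constant term;
  \<open>k = 1\<close> gives the additive maps.\<close>

fun polymap :: "nat \<Rightarrow> ('v::ab_group_add \<Rightarrow> 'g::ab_group_add) \<Rightarrow> bool" where
  "polymap 0 q \<longleftrightarrow> q = 0"
| "polymap (Suc k) q \<longleftrightarrow> (\<forall>v. polymap k (pdiff q v))"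

lemma pdiff_zero [simp]: "pdiff 0 v = 0"
  by (simp add: pdiff_def fun_eq_iff)

lemma pdiff_diff: "pdiff (q - r) v = pdiff q v - pdiff r v"
  by (simp add: pdiff_def fun_eq_iff algebra_simps)

lemma polymap_zero [simp]: "polymap k 0"
  unfolding zero_fun_def by (induction k) (auto simp: pdiff_def[abs_def] zero_fun_def)

lemma polymap_diff: "polymap k q \<Longrightarrow> polymap k r \<Longrightarrow> polymap k (q - r)"
  by (induction k arbitrary: q r) (auto simp: pdiff_diff)

lemma polymap_at_zero: "polymap k q \<Longrightarrow> q 0 = 0"
proof (induction k arbitrary: q)
  case (Suc k)
  then have "pdiff q 0 0 = 0" by simp
  then show ?case by (simp add: pdiff_def)
qed simp

lemma subgrp_polymap: "subgrp Q \<Longrightarrow> subgrp {q \<in> Q. polymap k q}"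
  by (auto simp: subgrp_def polymap_diff)

text \<open>Reduces positive definiteness of a limit to its sign at \<open>0\<close>, for all
  positive definite functions at once.\<close>

lemma sum_qlim_twist:
  assumes U: "ultrafilter U" and \<phi>: "posdef \<phi>"
  shows "(\<Sum>i<n::nat. \<Sum>j<n. a i * a j * qlim U q \<phi> (x i - x j)) = qlim U q (twist {..<n} a x \<phi>) 0"
proof (rule tendsto_unique[OF ultrafilter_nontrivial[OF U]])
  show "((\<lambda>w. twist {..<n} a x \<phi> (0 + q w)) \<longlongrightarrow> qlim U q (twist {..<n} a x \<phi>) 0) U"
    by (intro tendsto_qlim U posdef_twist \<phi>) simp
  show "((\<lambda>w. twist {..<n} a x \<phi> (0 + q w)) \<longlongrightarrow>
      (\<Sum>i<n. \<Sum>j<n. a i * a j * qlim U q \<phi> (x i - x j))) U"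
    unfolding twist_def add_0_left by (intro tendsto_intros tendsto_qlim U \<phi>)
qed

lemma posdef_qlim:
  assumes U: "ultrafilter U" and \<phi>: "posdef \<phi>"
    and nonneg: "\<And>\<psi>. posdef \<psi> \<Longrightarrow> 0 \<le> qlim U q \<psi> 0"
    and sym: "\<And>x. qlim U q \<phi> (- x) = qlim U q \<phi> x"
  shows "posdef (qlim U q \<phi>)"
  unfolding posdef_def sum_qlim_twist[OF U \<phi>] by (auto intro!: sym nonneg posdef_twist[OF \<phi>])

lemma posdef_diff_qlim:
  assumes U: "ultrafilter U" and \<phi>: "posdef \<phi>"
    and sym: "\<And>x. qlim U q \<phi> (- x) = qlim U q \<phi> x"
  shows "posdef (\<lambda>x. \<phi> x - qlim U q \<phi> x)"
proof -
  have "0 \<le> (\<Sum>i<n. \<Sum>j<n. a i * a j * (\<phi> (x i - x j) - qlim U q \<phi> (x i - x j)))" for n :: nat and a x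
  proof -
    have "(\<Sum>i<n. \<Sum>j<n. a i * a j * (\<phi> (x i - x j) - qlim U q \<phi> (x i - x j))) =
        twist {..<n} a x \<phi> 0 - qlim U q (twist {..<n} a x \<phi>) 0"
      unfolding sum_qlim_twist[OF U \<phi>, symmetric] by (simp add: right_diff_distrib sum_subtractf twist_def)
    then show ?thesis using abs_qlim_le[OF U posdef_twist[OF \<phi>], of "{..<n}" q a x 0] by simp
  qed
  then show ?thesis using sym \<phi> by (simp add: posdef_def)
qed

text \<open>Induction on the degree: the operators of \<open>pdiff q v\<close> are projections
  already, so \<open>pure_induction\<close> reduces each claim, phrased as
  \<open>S \<phi> \<le> 0\<close> for a subadditive \<open>S\<close>, to functions pure for these
  operators.\<close>

theorem projects_polymap:
  fixes U :: "'v::ab_group_add filter" and Q :: "('v \<Rightarrow> 'g::ab_group_add) set"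
  assumes U: "idempotent_ultrafilter (+) U"
    and Q: "subgrp Q" "noeth Q" and closed: "\<And>q v. q \<in> Q \<Longrightarrow> pdiff q v \<in> Q"
  shows "q \<in> Q \<Longrightarrow> polymap k q \<Longrightarrow> projects U q"
proof (induction k arbitrary: q)
  case 0
  then have "qlim U q \<phi> = \<phi>" for \<phi>
    using idempotent_ultra[OF U] by (simp add: qlim_def fun_eq_iff)
  then show ?case by (simp add: projects_def) (simp add: posdef_def)
next
  case (Suc k)
  note ultra = idempotent_ultra[OF U]
  define K where "K = {r \<in> Q. polymap k r}"
  have K: "pdiff q v \<in> K" for v using Suc.prems closed by (simp add: K_def)
  let ?J = "{U} \<times> K"
  have J: "\<And>V r. (V, r) \<in> ?J \<Longrightarrow> ultrafilter V" "\<And>V r. (V, r) \<in> ?J \<Longrightarrow> projects V r"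
    using ultra Suc.IH by (auto simp: K_def)
  have wf: "wf {(fixset ?J \<psi>, fixset ?J \<phi>) | \<phi> \<psi>. posdef \<phi> \<and> posdef \<psi> \<and> fixset ?J \<phi> \<subset> fixset ?J \<psi>}"
    by (rule wf_fixset) (use ultra subgrp_polymap[OF Q(1)] noeth_subset[OF Q(2)] in \<open>auto simp: K_def\<close>)
  have induct: "S \<phi> \<le> 0"
    if "\<And>\<phi> \<psi>. posdef \<phi> \<Longrightarrow> posdef \<psi> \<Longrightarrow> S (\<lambda>x. \<phi> x + \<psi> x) \<le> S \<phi> + S \<psi>"
      "\<And>\<phi>. posdef \<phi> \<Longrightarrow> S \<phi> \<le> C * \<phi> 0" "\<And>\<phi>. pure ?J \<phi> \<Longrightarrow> S \<phi> \<le> 0" "posdef \<phi>"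
    for S C and \<phi> :: "'g \<Rightarrow> real"
    by (rule pure_induction[where J = ?J and S = S and C = C]) (fact J wf that)+
  let ?L = "qlim U q"
  \<comment> \<open>The ultrafilter decides whether \<open>pdiff q v\<close> fixes \<phi> for almost
    all \<open>v\<close> or annihilates it for almost all \<open>v\<close>; the latter is the
    orthogonality needed by \<open>van_der_Corput\<close>.\<close>
  have cases: "(\<forall>\<^sub>F v in U. qlim U (pdiff q v) \<phi> = \<phi>) \<or> (\<forall>x. ?L \<phi> x = 0)" if "pure ?J \<phi>" for \<phi>
  proof (cases "\<forall>\<^sub>F v in U. qlim U (pdiff q v) \<phi> = \<phi>")
    case False
    have \<phi>: "posdef \<phi>" using that by (simp add: pure_def)
    from False have "\<forall>\<^sub>F v in U. qlim U (pdiff q v) \<phi> \<noteq> \<phi>" using ultrafilter_not_iff[OF ultra] by blast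
    then have zero: "\<forall>\<^sub>F v in U. qlim U (pdiff q v) \<phi> = (\<lambda>_. 0)"
      by eventually_elim (use that K in \<open>auto simp: pure_def\<close>)
    have "?L \<phi> x = 0" for x
    proof (rule van_der_Corput[OF U \<phi>])
      fix \<epsilon> :: real assume "\<epsilon> > 0"
      show "\<forall>\<^sub>F a in U. \<forall>\<^sub>F b in U. \<bar>\<phi> (q (a + b) - q b)\<bar> < \<epsilon>"
        using zero
      proof eventually_elim
        case (elim a)
        have "((\<lambda>b. \<phi> (q a + pdiff q a b)) \<longlongrightarrow> 0) U"
          using tendsto_qlim[OF ultra \<phi>, of "q a" "pdiff q a"] elim by simp
        then have "((\<lambda>b. \<phi> (q (a + b) - q b)) \<longlongrightarrow> 0) U" by (simp add: pdiff_def algebra_simps)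
        from tendstoD[OF this \<open>\<epsilon> > 0\<close>] show ?case by simp
      qed
    qed
    then show ?thesis by blast
  qed simp
  have shift: "\<forall>\<^sub>F b in U. \<bar>\<phi> (s b + pdiff q a b) - \<phi> (s b)\<bar> < \<epsilon>"
    if "posdef \<phi>" "qlim U (pdiff q a) \<phi> = \<phi>" "\<epsilon> > 0" for \<phi> a s \<epsilon>
    using tendstoD[OF tendsto_shift[OF ultrafilter_nontrivial[OF ultra] that(1)] that(3), of "pdiff q a" s]
      that by (simp add: qlim_eq_self_iff[OF ultra])
  have near: "\<forall>\<^sub>F w in U. \<bar>\<phi> (x + q w) - ?L \<phi> x\<bar> < \<epsilon>" if "posdef \<phi>" "\<epsilon> > 0" for \<phi> x \<epsilon>
    using tendstoD[OF tendsto_qlim[OF ultra that(1)] that(2)] by (simp add: dist_real_def)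
  \<comment> \<open>Invariance under \<open>pdiff q a\<close> lets \<open>q a\<close> replace
    \<open>q (a + b) - q b\<close>, which gives the hypothesis of both suffix limit lemmas.\<close>
  have kernel: "\<forall>\<^sub>F a in U. \<forall>\<^sub>F b in U. \<bar>\<phi> (x + q (a + b) - q b) - ?L \<phi> x\<bar> < \<epsilon>"
    if \<phi>: "posdef \<phi>" and fix_q: "\<forall>\<^sub>F v in U. qlim U (pdiff q v) \<phi> = \<phi>" and "\<epsilon> > 0" for \<phi> x \<epsilon>
  proof -
    have e2: "\<epsilon> / 2 > 0" using \<open>\<epsilon> > 0\<close> by simp
    show ?thesis
      using fix_q near[OF \<phi> e2, of x]
    proof eventually_elim
      case (elim a)
      from shift[OF \<phi> elim(1) e2, of "\<lambda>_. x + q a"] show ?case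
      proof eventually_elim
        case (elim b)
        have "x + q a + pdiff q a b = x + q (a + b) - q b" by (simp add: pdiff_def algebra_simps)
        with elim have "\<bar>\<phi> (x + q (a + b) - q b) - \<phi> (x + q a)\<bar> < \<epsilon> / 2" by simp
        with \<open>\<bar>\<phi> (x + q a) - ?L \<phi> x\<bar> < \<epsilon> / 2\<close> show ?case by linarith
      qed
    qed
  qed
  have add: "?L (\<lambda>x. \<phi> x + \<psi> x) = (\<lambda>x. ?L \<phi> x + ?L \<psi> x)" if "posdef \<phi>" "posdef \<psi>" for \<phi> \<psi>
    by (rule qlim_add[OF ultra that])
  have bound: "\<bar>?L \<phi> x\<bar> \<le> \<phi> 0" if "posdef \<phi>" for \<phi> x
    by (rule abs_qlim_le[OF ultra that])
  have nonneg: "0 \<le> ?L \<phi> 0" if \<phi>: "posdef \<phi>" for \<phi>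
  proof -
    have "- ?L \<phi> 0 \<le> 0"
    proof (rule induct[where C = 1, OF _ _ _ \<phi>])
      fix \<psi> :: "'g \<Rightarrow> real" assume \<psi>: "pure ?J \<psi>"
      then have "posdef \<psi>" by (simp add: pure_def)
      then show "- ?L \<psi> 0 \<le> 0"
        using cases[OF \<psi>] suffix_limit_nonneg[OF U, of \<psi> q "?L \<psi> 0"] kernel[of \<psi> _ 0] by auto
    qed (use bound[of _ 0] in \<open>auto simp: add abs_le_iff\<close>)
    then show ?thesis by simp
  qed
  have sym: "?L \<phi> (- x) = ?L \<phi> x" if \<phi>: "posdef \<phi>" for \<phi> x
  proof -
    have "\<bar>?L \<phi> (- x) - ?L \<phi> x\<bar> \<le> 0"
    proof (rule induct[where C = 2, OF _ _ _ \<phi>])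
      fix \<psi> :: "'g \<Rightarrow> real" assume \<psi>: "pure ?J \<psi>"
      then have "posdef \<psi>" by (simp add: pure_def)
      then show "\<bar>?L \<psi> (- x) - ?L \<psi> x\<bar> \<le> 0"
        using cases[OF \<psi>] suffix_limit_symmetric[OF U, of \<psi> q "?L \<psi>"] kernel[of \<psi>] by auto
    next
      fix \<psi> :: "'g \<Rightarrow> real" assume "posdef \<psi>"
      then show "\<bar>?L \<psi> (- x) - ?L \<psi> x\<bar> \<le> 2 * \<psi> 0" using bound[of \<psi> x] bound[of \<psi> "- x"] by simp
    qed (simp add: add)
    then show ?thesis by simp
  qed
  have pd: "posdef (?L \<phi>)" if "posdef \<phi>" for \<phi>
    by (rule posdef_qlim[OF ultra that nonneg sym[OF that]])
  show ?case
    unfolding projects_def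
  proof (intro allI impI conjI ext)
    fix \<phi> :: "'g \<Rightarrow> real" and x assume \<phi>: "posdef \<phi>"
    show "posdef (?L \<phi>)" by (rule pd[OF \<phi>])
    show "posdef (\<lambda>x. \<phi> x - ?L \<phi> x)" by (rule posdef_diff_qlim[OF ultra \<phi> sym[OF \<phi>]])
    have "\<bar>?L (?L \<phi>) x - ?L \<phi> x\<bar> \<le> 0"
    proof (rule induct[where C = 2, OF _ _ _ \<phi>])
      fix \<psi> :: "'g \<Rightarrow> real" assume \<psi>: "pure ?J \<psi>"
      then have p\<psi>: "posdef \<psi>" by (simp add: pure_def)
      from cases[OF \<psi>] have "?L (?L \<psi>) x = ?L \<psi> x"
      proof
        assume fix_q: "\<forall>\<^sub>F v in U. qlim U (pdiff q v) \<psi> = \<psi>"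
        \<comment> \<open>By invariance \<open>\<psi> (x + q v + q w)\<close> is close to
          \<open>\<psi> (x + q (v + w))\<close>, whose double limit is a single limit since
          \<open>U\<close> is idempotent.\<close>
        have "((\<lambda>v. ?L \<psi> (x + q v)) \<longlongrightarrow> ?L \<psi> x) U"
        proof (rule tendstoI)
          fix \<epsilon> :: real assume "\<epsilon> > 0"
          then have e3: "\<epsilon> / 3 > 0" by simp
          from fix_q idempotentD[OF U near[OF p\<psi> e3, of x]]
          show "\<forall>\<^sub>F v in U. dist (?L \<psi> (x + q v)) (?L \<psi> x) < \<epsilon>"
          proof eventually_elim
            case (elim v)
            have "\<forall>\<^sub>F w in U. \<bar>?L \<psi> (x + q v) - ?L \<psi> x\<bar> < \<epsilon>"
              using elim(2) shift[OF p\<psi> elim(1) e3, of "\<lambda>w. x + q v + q w"] near[OF p\<psi> e3, of "x + q v"]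
            proof eventually_elim
              case (elim w)
              have "x + q v + q w + pdiff q v w = x + q (v + w)" by (simp add: pdiff_def algebra_simps)
              with elim(2) have "\<bar>\<psi> (x + q (v + w)) - \<psi> (x + q v + q w)\<bar> < \<epsilon> / 3" by simp
              with elim(1,3) show ?case by linarith
            qed
            then show ?case using ultrafilter_nontrivial[OF ultra] by (simp add: dist_real_def)
          qed
        qed
        then show ?thesis unfolding qlim_def[of U q "?L \<psi>"] by (rule ulim_eqI[OF ultra])
      next
        assume "\<forall>x. ?L \<psi> x = 0"
        then have "?L \<psi> = (\<lambda>_. 0)" by auto
        then show ?thesis using ultra by simp
      qed
      then show "\<bar>?L (?L \<psi>) x - ?L \<psi> x\<bar> \<le> 0" by simp
    next
      fix \<psi> :: "'g \<Rightarrow> real" assume \<psi>: "posdef \<psi>"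
      then show "\<bar>?L (?L \<psi>) x - ?L \<psi> x\<bar> \<le> 2 * \<psi> 0"
        using bound[OF pd[OF \<psi>], of x] bound[OF \<psi>, of x] bound[OF \<psi>, of 0] by simp
    next
      fix \<psi> \<chi> :: "'g \<Rightarrow> real" assume "posdef \<psi>" "posdef \<chi>"
      then show "\<bar>?L (?L (\<lambda>x. \<psi> x + \<chi> x)) x - ?L (\<lambda>x. \<psi> x + \<chi> x) x\<bar>
          \<le> \<bar>?L (?L \<psi>) x - ?L \<psi> x\<bar> + \<bar>?L (?L \<chi>) x - ?L \<chi> x\<bar>"
        by (simp add: add pd)
    qed
    then show "?L (?L \<phi>) x = ?L \<phi> x" by simp
  qed
qed

section \<open>Iterated limits\<close>

text \<open>Iterated limits of \<open>f\<close> at sums of points, where the next filter and the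
  number of remaining limits may depend on the points so far. The trees are well founded, but their
  depth need not be bounded.\<close>

inductive_set treelim :: "'v::ab_group_add filter set \<Rightarrow> (('v \<Rightarrow> real) \<Rightarrow> real) set" for \<U> where
  treelim_eval: "(\<lambda>f. f 0) \<in> treelim \<U>"
| treelim_ulim: "U \<in> \<U> \<Longrightarrow> (\<And>v. l v \<in> treelim \<U>) \<Longrightarrow>
    (\<lambda>f. ulim U (\<lambda>v. l v (\<lambda>w. f (v + w)))) \<in> treelim \<U>"

lemma treelim_abs_le:
  assumes "\<And>U. U \<in> \<U> \<Longrightarrow> ultrafilter U"
  shows "l \<in> treelim \<U> \<Longrightarrow> (\<And>v. \<bar>f v\<bar> \<le> B) \<Longrightarrow> \<bar>l f\<bar> \<le> B"
proof (induction arbitrary: f rule: treelim.induct)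
  case (treelim_ulim U l)
  then show ?case using assms by (intro ulim_abs_le always_eventually) auto
qed

lemma treelim_add:
  assumes "\<And>U. U \<in> \<U> \<Longrightarrow> ultrafilter U"
  shows "l \<in> treelim \<U> \<Longrightarrow> (\<And>v. \<bar>f v\<bar> \<le> B) \<Longrightarrow> (\<And>v. \<bar>g v\<bar> \<le> C) \<Longrightarrow>
    l (\<lambda>v. f v + g v) = l f + l g"
proof (induction arbitrary: f g rule: treelim.induct)
  case (treelim_ulim U l)
  have "ulim U (\<lambda>v. l v (\<lambda>w. f (v + w) + g (v + w))) =
      ulim U (\<lambda>v. l v (\<lambda>w. f (v + w)) + l v (\<lambda>w. g (v + w)))"
    using treelim_ulim by simp
  also have "\<dots> = ulim U (\<lambda>v. l v (\<lambda>w. f (v + w))) + ulim U (\<lambda>v. l v (\<lambda>w. g (v + w)))"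
  proof (rule ulim_add[of _ _ B _ C])
    show "ultrafilter U" using assms treelim_ulim.hyps(1) .
    show "\<forall>\<^sub>F v in U. \<bar>l v (\<lambda>w. f (v + w))\<bar> \<le> B"
      by (intro always_eventually allI treelim_abs_le[OF assms treelim_ulim.hyps(2)] treelim_ulim.prems)
    show "\<forall>\<^sub>F v in U. \<bar>l v (\<lambda>w. g (v + w))\<bar> \<le> C"
      by (intro always_eventually allI treelim_abs_le[OF assms treelim_ulim.hyps(2)] treelim_ulim.prems)
  qed
  finally show ?case .
qed simp

theorem treelim_nonneg:
  fixes Q :: "('v::ab_group_add \<Rightarrow> 'g::ab_group_add) set"
  assumes \<U>: "finite \<U>" "\<And>U. U \<in> \<U> \<Longrightarrow> idempotent_ultrafilter (+) U"
    and Q: "subgrp Q" "noeth Q" and closed: "\<And>q v. q \<in> Q \<Longrightarrow> pdiff q v \<in> Q"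
    and deg: "\<And>q. q \<in> Q \<Longrightarrow> \<exists>k. polymap k q"
    and l: "l \<in> treelim \<U>" and q: "q \<in> Q" and \<phi>: "posdef \<phi>"
  shows "0 \<le> l (\<lambda>w. \<phi> (q w))"
proof -
  have ultra: "\<And>U. U \<in> \<U> \<Longrightarrow> ultrafilter U" using \<U>(2) idempotent_ultra by blast
  let ?J = "\<U> \<times> Q"
  have J: "\<And>U r. (U, r) \<in> ?J \<Longrightarrow> ultrafilter U" "\<And>U r. (U, r) \<in> ?J \<Longrightarrow> projects U r"
    using ultra projects_polymap[OF \<U>(2) Q closed] deg by blast+
  have wf: "wf {(fixset ?J \<psi>, fixset ?J \<phi>) | \<phi> \<psi>. posdef \<phi> \<and> posdef \<psi> \<and> fixset ?J \<phi> \<subset> fixset ?J \<psi>}"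
    by (rule wf_fixset) (fact \<U>(1) ultra Q)+
  \<comment> \<open>The alternative is uniform in the translate \<open>x\<close>, so that the
    induction can absorb \<open>q v\<close> into \<open>x\<close>.\<close>
  have pure: "(\<forall>x. l (\<lambda>w. \<psi> (x + q w)) = \<psi> x) \<or> (\<forall>x. l (\<lambda>w. \<psi> (x + q w)) = 0)"
    if \<psi>: "pure ?J \<psi>" and "l \<in> treelim \<U>" "q \<in> Q" for \<psi> l q
    using that(2,3)
  proof (induction arbitrary: q rule: treelim.induct)
    case treelim_eval
    then show ?case using deg polymap_at_zero by fastforce
  next
    case (treelim_ulim U l)
    note U = ultra[OF treelim_ulim.hyps(1)]
    \<comment> \<open>\<open>r v w\<close> equals \<open>q (v + w) - q v\<close>, and
      \<open>r v\<close> stays in \<open>Q\<close>.\<close>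
    define r where "r v = q + pdiff q v" for v
    have r: "r v \<in> Q" for v
    proof -
      have "0 - pdiff q v \<in> Q" using Q(1) closed[OF treelim_ulim.prems] unfolding subgrp_def by blast
      then have "q - (0 - pdiff q v) \<in> Q" using Q(1) treelim_ulim.prems unfolding subgrp_def by blast
      then show ?thesis by (simp add: r_def)
    qed
    have shift: "\<psi> (x + q (v + w)) = \<psi> (x + q v + r v w)" for x v w
      by (simp add: r_def pdiff_def algebra_simps)
    show ?case
    \<comment> \<open>The inner functional is the identity for almost all \<open>v\<close>, leaving
      \<open>qlim U q \<psi>\<close> to purity, or it is \<open>0\<close> for almost all
      \<open>v\<close>.\<close>
    proof (cases "\<forall>\<^sub>F v in U. \<forall>x. l v (\<lambda>w. \<psi> (x + r v w)) = \<psi> x")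
      case True
      have "ulim U (\<lambda>v. l v (\<lambda>w. \<psi> (x + q (v + w)))) = qlim U q \<psi> x" for x
        unfolding qlim_def shift by (rule ulim_cong) (use True in eventually_elim, simp)
      moreover have "qlim U q \<psi> = \<psi> \<or> qlim U q \<psi> = (\<lambda>_. 0)"
        using \<psi> treelim_ulim.hyps(1) treelim_ulim.prems by (auto simp: pure_def)
      ultimately show ?thesis by auto
    next
      case False
      then have "\<forall>\<^sub>F v in U. \<not> (\<forall>x. l v (\<lambda>w. \<psi> (x + r v w)) = \<psi> x)"
        using ultrafilter_not_iff[OF U] by blast
      then have ev: "\<forall>\<^sub>F v in U. \<forall>x. l v (\<lambda>w. \<psi> (x + r v w)) = 0"
        by eventually_elim (use treelim_ulim.IH[OF r] in blast)
      have "ulim U (\<lambda>v. l v (\<lambda>w. \<psi> (x + q (v + w)))) = ulim U (\<lambda>_. 0)" for x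
        unfolding shift by (rule ulim_cong) (use ev in eventually_elim, simp)
      then show ?thesis using U by simp
    qed
  qed
  have "- l (\<lambda>w. \<phi> (q w)) \<le> 0"
  proof (rule pure_induction[where J = ?J and C = 1, OF _ _ _ _ _ _ \<phi>])
    fix \<psi> :: "'g \<Rightarrow> real" assume "pure ?J \<psi>"
    moreover from this have "0 \<le> \<psi> 0" by (simp add: pure_def posdef_zero_nonneg)
    ultimately show "- l (\<lambda>w. \<psi> (q w)) \<le> 0"
      using pure[OF _ l q, of \<psi>] by (auto dest: spec[of _ 0])
  next
    fix \<psi> :: "'g \<Rightarrow> real" assume "posdef \<psi>"
    then show "- l (\<lambda>w. \<psi> (q w)) \<le> 1 * \<psi> 0"
      using treelim_abs_le[OF ultra l, of "\<lambda>w. \<psi> (q w)" "\<psi> 0"] by (simp add: posdef_abs_le)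
  next
    fix \<psi> \<chi> :: "'g \<Rightarrow> real" assume "posdef \<psi>" "posdef \<chi>"
    then show "- l (\<lambda>w. \<psi> (q w) + \<chi> (q w)) \<le> - l (\<lambda>w. \<psi> (q w)) + - l (\<lambda>w. \<chi> (q w))"
      using treelim_add[OF ultra l, of "\<lambda>w. \<psi> (q w)" "\<psi> 0" "\<lambda>w. \<chi> (q w)" "\<chi> 0"]
      by (simp add: posdef_abs_le)
  qed (fact J wf)+
  then show ?thesis by simp
qed

text \<open>
  If the set of bad \<open>v\<close> were large, the functionals witnessing badness would assemble to a tree
  limit violating the hypothesis. This uniformity over all tree limits is what allows the
  selection of an infinite sequence.
\<close>

lemma treelim_shift:
  assumes ultra: "\<And>U. U \<in> \<U> \<Longrightarrow> ultrafilter U" and "U \<in> \<U>"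
    and B: "\<And>v. \<bar>f v\<bar> \<le> B" and c: "\<And>l. l \<in> treelim \<U> \<Longrightarrow> a \<le> l (\<lambda>w. f (c + w))" and "b < a"
  shows "\<forall>\<^sub>F v in U. \<forall>l\<in>treelim \<U>. b \<le> l (\<lambda>w. f (c + v + w))"
proof (rule ccontr)
  note U = ultra[OF assms(2)]
  assume "\<not> ?thesis"
  then have ev: "\<forall>\<^sub>F v in U. \<not> (\<forall>l\<in>treelim \<U>. b \<le> l (\<lambda>w. f (c + v + w)))"
    using ultrafilter_not_iff[OF U] by blast
  \<comment> \<open>At a \<open>v\<close> that is not bad any tree limit will do; evaluation serves,
    so that \<open>l v\<close> is a tree limit for every \<open>v\<close>.\<close>
  have "\<exists>l\<in>treelim \<U>. \<not> (\<forall>l\<in>treelim \<U>. b \<le> l (\<lambda>w. f (c + v + w))) \<longrightarrow> l (\<lambda>w. f (c + v + w)) < b" for v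
    using treelim_eval[of \<U>] by (auto simp: not_le)
  then obtain l where l: "\<And>v. l v \<in> treelim \<U>"
    "\<And>v. \<not> (\<forall>l\<in>treelim \<U>. b \<le> l (\<lambda>w. f (c + v + w))) \<Longrightarrow> l v (\<lambda>w. f (c + v + w)) < b" by metis
  have "a \<le> ulim U (\<lambda>v. l v (\<lambda>w. f (c + (v + w))))"
    using c[OF treelim_ulim[of U \<U> l, OF assms(2) l(1)]] by simp
  also have "\<dots> \<le> ulim U (\<lambda>_. b)"
  proof (rule ulim_mono[OF U, of _ B _ "\<bar>b\<bar>"])
    show "\<forall>\<^sub>F v in U. \<bar>l v (\<lambda>w. f (c + (v + w)))\<bar> \<le> B"
      using treelim_abs_le[OF ultra l(1)] B by (intro always_eventually) auto
    show "\<forall>\<^sub>F v in U. l v (\<lambda>w. f (c + (v + w))) \<le> b"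
      using ev by eventually_elim (use l(2) in \<open>auto simp: add.assoc less_imp_le\<close>)
  qed simp
  finally show False using \<open>b < a\<close> U by simp
qed

section \<open>Noetherian groups of polynomial maps\<close>

lemma subgrp_image:
  assumes "subgrp H" "\<And>x y. x \<in> H \<Longrightarrow> y \<in> H \<Longrightarrow> \<pi> (x - y) = \<pi> x - \<pi> y"
  shows "subgrp (\<pi> ` H)"
  unfolding subgrp_def
proof (intro conjI ballI)
  have "\<pi> 0 = 0" using assms(2)[of 0 0] assms(1) by (simp add: subgrp_def)
  then show "0 \<in> \<pi> ` H" using assms(1) by (metis image_eqI subgrp_def)
  fix x y assume "x \<in> \<pi> ` H" "y \<in> \<pi> ` H"
  then obtain x' y' where xy: "x' \<in> H" "y' \<in> H" "x = \<pi> x'" "y = \<pi> y'" by blast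
  then have "x - y = \<pi> (x' - y')" using assms(2) by simp
  moreover have "x' - y' \<in> H" using xy assms(1) by (simp add: subgrp_def)
  ultimately show "x - y \<in> \<pi> ` H" by blast
qed

text \<open>Once the images under \<pi> and the intersections with its kernel are constant, so is
  the chain: a later element differs from an earlier one by a kernel element.\<close>

lemma noeth_extension:
  assumes hom: "\<And>x y. x \<in> G \<Longrightarrow> y \<in> G \<Longrightarrow> \<pi> (x - y) = \<pi> x - \<pi> y"
    and "noeth (\<pi> ` G)" "noeth {x \<in> G. \<pi> x = 0}"
  shows "noeth G"
  unfolding noeth_def
proof (intro allI impI)
  fix H assume "\<forall>n::nat. subgrp (H n) \<and> H n \<subseteq> G \<and> H n \<subseteq> H (Suc n)"
  then have H: "\<And>n. subgrp (H n)" "\<And>n. H n \<subseteq> G" "\<And>n. H n \<subseteq> H (Suc n)" by auto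
  obtain N1 where N1: "\<And>n. n \<ge> N1 \<Longrightarrow> \<pi> ` H n = \<pi> ` H N1"
  proof (rule noethE[OF assms(2), of "\<lambda>n. \<pi> ` H n"])
    show "subgrp (\<pi> ` H n)" for n
      using H(1,2) by (intro subgrp_image) (auto intro!: hom)
  qed (use H in \<open>blast+\<close>)
  obtain N2 where N2: "\<And>n. n \<ge> N2 \<Longrightarrow> {x \<in> H n. \<pi> x = 0} = {x \<in> H N2. \<pi> x = 0}"
  proof (rule noethE[OF assms(3), of "\<lambda>n. {x \<in> H n. \<pi> x = 0}"])
    show "subgrp {x \<in> H n. \<pi> x = 0}" for n
      unfolding subgrp_def
    proof (intro conjI ballI)
      have z: "0 \<in> H n" using H(1)[of n] by (simp add: subgrp_def)
      then have "\<pi> (0 - 0) = \<pi> 0 - \<pi> 0" using H(2) by (intro hom) auto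
      then show "0 \<in> {x \<in> H n. \<pi> x = 0}" using z by simp
      fix x y assume "x \<in> {x \<in> H n. \<pi> x = 0}" "y \<in> {x \<in> H n. \<pi> x = 0}"
      moreover from this have "\<pi> (x - y) = \<pi> x - \<pi> y" using H(2) by (intro hom) auto
      ultimately show "x - y \<in> {x \<in> H n. \<pi> x = 0}" using H(1)[of n] by (simp add: subgrp_def)
    qed
  qed (use H in \<open>blast+\<close>)
  have "H n = H (max N1 N2)" if n: "n \<ge> max N1 N2" for n
  proof
    let ?M = "max N1 N2"
    show "H ?M \<subseteq> H n" by (rule lift_Suc_mono_le[of H, OF H(3) n])
    show "H n \<subseteq> H ?M"
    proof
      fix x assume x: "x \<in> H n"
      have "\<pi> ` H n = \<pi> ` H ?M" using N1[of n] N1[of ?M] n by simp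
      then obtain y where y: "y \<in> H ?M" "\<pi> x = \<pi> y" using x by blast
      have yn: "y \<in> H n" using y(1) \<open>H ?M \<subseteq> H n\<close> by blast
      then have "x - y \<in> H n" using x H(1)[of n] by (simp add: subgrp_def)
      moreover have "\<pi> (x - y) = 0" using x yn y(2) H(2)[of n] by (subst hom) auto
      ultimately have "x - y \<in> {x \<in> H n. \<pi> x = 0}" by simp
      also have "\<dots> = {x \<in> H ?M. \<pi> x = 0}" using N2[of n] N2[of ?M] n by simp
      finally have "x - y \<in> H ?M" by simp
      moreover have "0 - y \<in> H ?M" using y(1) H(1)[of ?M] unfolding subgrp_def by blast
      ultimately have "(x - y) - (0 - y) \<in> H ?M" using H(1)[of ?M] unfolding subgrp_def by blast
      then show "x \<in> H ?M" by simp
    qed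
  qed
  then show "\<exists>N. \<forall>n\<ge>N. H n = H N" by blast
qed

lemma noeth_finite:
  assumes "finite G"
  shows "noeth G"
  unfolding noeth_def
proof (intro allI impI)
  fix H assume "\<forall>n::nat. subgrp (H n) \<and> H n \<subseteq> G \<and> H n \<subseteq> H (Suc n)"
  then have H: "\<And>n. H n \<subseteq> G" "mono H" by (auto simp: mono_iff_le_Suc)
  have "\<exists>N. \<forall>n. card (H n) \<le> card (H N)"
    using H(1) assms by (intro ex_has_greatest_nat[of "\<lambda>_. True" 0 "\<lambda>n. card (H n)" "Suc (card G)", simplified])
      (auto simp: less_Suc_eq_le intro!: card_mono)
  then obtain N where N: "\<And>n. card (H n) \<le> card (H N)" by blast
  have "H n = H N" if "n \<ge> N" for n
    using card_seteq[of "H n" "H N"] N H monoD[OF H(2) that] assms by (metis finite_subset)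
  then show "\<exists>N. \<forall>n\<ge>N. H n = H N" by blast
qed

lemma subgrp_int_dvd:
  fixes H :: "int set"
  assumes "subgrp H" "a \<in> H" "a > 0" and least: "\<And>b. b \<in> H \<Longrightarrow> b > 0 \<Longrightarrow> a \<le> b"
  shows "H = {x. a dvd x}"
proof -
  have minus: "- x \<in> H" if "x \<in> H" for x
    using assms(1) that unfolding subgrp_def by (metis diff_0)
  then have add: "x + y \<in> H" if "x \<in> H" "y \<in> H" for x y
    using assms(1) that unfolding subgrp_def by (metis diff_minus_eq_add)
  have "of_nat n * a \<in> H" for n
    by (induction n) (use assms(1,2) add in \<open>auto simp: subgrp_def algebra_simps\<close>)
  then have mult: "k * a \<in> H" for k
    using minus by (cases k rule: int_cases2) (auto simp flip: minus_mult_left)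
  have "a dvd x" if "x \<in> H" for x
  proof -
    have "x - x div a * a \<in> H" using assms(1) that mult unfolding subgrp_def by blast
    then have "x mod a \<in> H" by (simp add: minus_div_mult_eq_mod)
    then have "x mod a = 0" using least[of "x mod a"] pos_mod_bound[OF assms(3), of x] pos_mod_sign[OF assms(3), of x] by force
    then show ?thesis by (simp add: dvd_eq_mod_eq_0)
  qed
  moreover have "x \<in> H" if "a dvd x" for x
    using that mult by (auto simp: dvd_def mult.commute)
  ultimately show ?thesis by blast
qed

lemma noeth_int: "noeth (UNIV :: int set)"
  unfolding noeth_def
proof (intro allI impI)
  fix H :: "nat \<Rightarrow> int set" assume "\<forall>n. subgrp (H n) \<and> H n \<subseteq> UNIV \<and> H n \<subseteq> H (Suc n)"
  then have H: "\<And>n. subgrp (H n)" "mono H" by (auto simp: mono_iff_le_Suc)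
  show "\<exists>N. \<forall>n\<ge>N. H n = H N"
  proof (cases "\<exists>n. \<exists>a\<in>H n. a \<noteq> 0")
    case False
    then have "H n = {0}" for n using H(1)[of n] by (auto simp: subgrp_def)
    then show ?thesis by blast
  next
    case True
    then obtain n a where a: "a \<in> H n" "a \<noteq> 0" by blast
    then have "0 - a \<in> H n" using H(1)[of n] unfolding subgrp_def by blast
    then have "\<bar>a\<bar> \<in> H n" using a(1) by (simp add: abs_if)
    then have "\<exists>k n. int k \<in> H n \<and> k > 0" using a(2) by (intro exI[of _ "nat \<bar>a\<bar>"] exI[of _ n]) auto
    \<comment> \<open>\<open>k\<close> is the least positive integer in any group of the chain; from
      stage \<open>N\<close> on it generates each of them.\<close>
    then obtain k N where k: "int k \<in> H N" "k > 0" "\<And>k' n. int k' \<in> H n \<Longrightarrow> k' > 0 \<Longrightarrow> k \<le> k'"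
      using exists_least_iff[of "\<lambda>k. \<exists>n. int k \<in> H n \<and> k > 0"] by (metis not_le)
    have "H n = {x. int k dvd x}" if "n \<ge> N" for n
    proof (rule subgrp_int_dvd[OF H(1)])
      show "int k \<in> H n" using monoD[OF H(2) that] k(1) by blast
      show "int k \<le> b" if "b \<in> H n" "b > 0" for b
        using k(3)[of "nat b" n] that by auto
    qed (use k(2) in simp)
    then show ?thesis by (intro exI[of _ N]) auto
  qed
qed

lemma noeth_int_vecs: "noeth (int_vecs d)"
proof (induction d)
  case 0
  have "int_vecs 0 = {0}" by (auto simp: int_vecs_def fun_eq_iff)
  then show ?case by (simp add: noeth_finite)
next
  case (Suc d)
  show ?case
  proof (rule noeth_extension[of _ "\<lambda>x. x d"])
    have "{x \<in> int_vecs (Suc d). x d = 0} \<subseteq> int_vecs d"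
      by (auto simp: int_vecs_def) (metis le_neq_implies_less Suc_leI)
    then show "noeth {x \<in> int_vecs (Suc d). x d = 0}" by (rule noeth_subset[OF Suc])
  qed (auto intro: noeth_subset[OF noeth_int])
qed

definition truncate :: "nat \<Rightarrow> (nat \<Rightarrow> int) \<Rightarrow> nat \<Rightarrow> int" where
  "truncate m x = (\<lambda>i. if i < m then x i else 0)"

text \<open>The maps live on all of \<open>nat \<Rightarrow> int\<close> so that the domain is a
  group type; invariance under truncation restricts them to \<open>m\<close> coordinates.\<close>

definition vec_polymaps :: "nat \<Rightarrow> nat \<Rightarrow> nat \<Rightarrow> ((nat \<Rightarrow> int) \<Rightarrow> (nat \<Rightarrow> int)) set" where
  "vec_polymaps m d k = {q. polymap k q \<and> (\<forall>x. q (truncate m x) = q x \<and> q x \<in> int_vecs d)}"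

lemma subgrp_vec_polymaps: "subgrp (vec_polymaps m d k)"
  by (auto simp: subgrp_def vec_polymaps_def polymap_diff int_vecs_def)

lemma polymap_pdiff: "polymap k q \<Longrightarrow> polymap k (pdiff q v)"
  by (induction k arbitrary: q v) simp_all

lemma pdiff_vec_polymaps: "q \<in> vec_polymaps m d k \<Longrightarrow> pdiff q v \<in> vec_polymaps m d k"
proof -
  assume q: "q \<in> vec_polymaps m d k"
  then have tr: "q (truncate m x) = q x" for x by (simp add: vec_polymaps_def)
  have "q (v + truncate m w) = q (v + w)" for w
  proof -
    have "truncate m (v + truncate m w) = truncate m (v + w)" by (auto simp: truncate_def)
    then show ?thesis using tr[of "v + truncate m w"] tr[of "v + w"] by simp
  qed
  then show ?thesis
    using q by (auto simp: vec_polymaps_def polymap_pdiff pdiff_def int_vecs_def)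
qed

definition unit_vec :: "nat \<Rightarrow> nat \<Rightarrow> int" where
  "unit_vec i = (\<lambda>j. if j = i then 1 else 0)"

lemma unit_shift_invariant:
  fixes q :: "(nat \<Rightarrow> int) \<Rightarrow> 'g"
  assumes tr: "\<And>x. q (truncate m x) = q x"
    and shift: "\<And>i v. i < m \<Longrightarrow> q (v + unit_vec i) = q v"
  shows "q x = q 0"
proof -
  have nat: "q (v + (\<lambda>j. if j = i then int n else 0)) = q v" if "i < m" for i n v
  proof (induction n)
    case (Suc n)
    have "v + (\<lambda>j. if j = i then int (Suc n) else 0) =
        v + (\<lambda>j. if j = i then int n else 0) + unit_vec i" by (auto simp: unit_vec_def)
    then show ?case using shift[OF that] Suc by metis
  next
    case 0
    have "(\<lambda>j. if j = i then int 0 else 0) = 0" by auto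
    then show ?case by simp
  qed
  have int: "q (v + (\<lambda>j. if j = i then z else 0)) = q v" if "i < m" for i z v
  proof (cases z rule: int_cases2)
    case (nonneg n)
    show ?thesis unfolding nonneg by (rule nat[OF that])
  next
    case (nonpos n)
    have "v + (\<lambda>j. if j = i then z else 0) + (\<lambda>j. if j = i then int n else 0) = v"
      using nonpos by auto
    then show ?thesis using nat[OF that, of "v + (\<lambda>j. if j = i then z else 0)" n] by (simp only:)
  qed
  have "q (truncate n x) = q 0" if "n \<le> m" for n
    using that
  proof (induction n)
    case (Suc n)
    have "truncate (Suc n) x = truncate n x + (\<lambda>j. if j = n then x n else 0)"
      by (auto simp: truncate_def less_Suc_eq)
    moreover have "q (truncate n x + (\<lambda>j. if j = n then x n else 0)) = q (truncate n x)"
      using Suc.prems by (intro int) simp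
    ultimately show ?case using Suc by (simp only: Suc_leD)
  next
    case 0
    have "truncate 0 x = 0" by (auto simp: truncate_def)
    then show ?case by simp
  qed
  from this[of m] tr show ?thesis by simp
qed

text \<open>
  A map in \<open>vec_polymaps m d (Suc k)\<close> is determined by the values and the differences at the \<open>m\<close>
  unit vectors, that is, by \<open>m\<close> elements of \<open>int_vecs d\<close> and \<open>m\<close> elements of \<open>vec_polymaps m d k\<close>.
\<close>

lemma noeth_vec_polymaps: "noeth (vec_polymaps m d k)"
proof (induction k)
  case 0
  have "vec_polymaps m d 0 \<subseteq> {0}" by (auto simp: vec_polymaps_def)
  then show ?case by (intro noeth_finite) (auto intro: finite_subset)
next
  case (Suc k)
  \<comment> \<open>\<open>?G m\<close> is trivial and \<open>?G 0\<close> is the whole group; each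
    step down adds one value and one difference by two extensions.\<close>
  let ?G = "\<lambda>n. {q \<in> vec_polymaps m d (Suc k). \<forall>i<n. q (unit_vec i) = 0 \<and> pdiff q (unit_vec i) = 0}"
  have "?G m \<subseteq> {0}"
  proof
    fix q assume "q \<in> ?G m"
    then have q: "\<And>x. q (truncate m x) = q x" "q 0 = 0"
      "\<And>i. i < m \<Longrightarrow> q (unit_vec i) = 0" "\<And>i v. i < m \<Longrightarrow> pdiff q (unit_vec i) v = 0"
      by (auto simp: vec_polymaps_def polymap_at_zero simp del: polymap.simps)
    have "q (v + unit_vec i) = q v" if "i < m" for i v
      using q(3)[OF that] q(4)[OF that, of v] by (simp add: pdiff_def add.commute)
    then have "q x = 0" for x using unit_shift_invariant[of q m x] q(1,2) by simp
    then show "q \<in> {0}" by (auto simp: fun_eq_iff)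
  qed
  then have base: "noeth (?G m)" by (intro noeth_finite) (auto intro: finite_subset)
  have step: "noeth (?G n)" if "noeth (?G (Suc n))" for n
  proof (rule noeth_extension[of _ "\<lambda>q. q (unit_vec n)"])
    show "noeth ((\<lambda>q. q (unit_vec n)) ` ?G n)"
      by (rule noeth_subset[OF noeth_int_vecs[of d]]) (auto simp: vec_polymaps_def)
    show "noeth {q \<in> ?G n. q (unit_vec n) = 0}"
    proof (rule noeth_extension[of _ "\<lambda>q. pdiff q (unit_vec n)"])
      show "noeth ((\<lambda>q. pdiff q (unit_vec n)) ` {q \<in> ?G n. q (unit_vec n) = 0})"
        by (rule noeth_subset[OF Suc])
          (use pdiff_vec_polymaps[of _ m d "Suc k"] in \<open>auto simp: vec_polymaps_def\<close>)
      show "noeth {q \<in> {q \<in> ?G n. q (unit_vec n) = 0}. pdiff q (unit_vec n) = 0}"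
        by (rule noeth_subset[OF that]) (auto simp: less_Suc_eq)
    qed (simp add: pdiff_diff)
  qed simp
  have "noeth (?G (m - n))" for n
  proof (induction n)
    case (Suc n)
    show ?case
    proof (cases "n < m")
      case True
      then show ?thesis using step[of "m - Suc n"] Suc unfolding Suc_diff_Suc[OF True] by blast
    next
      case False
      then have "m - Suc n = m - n" by simp
      then show ?thesis using Suc by (simp only:)
    qed
  qed (use base in \<open>simp only: diff_zero\<close>)
  from this[of m] have "noeth (?G 0)" unfolding diff_self_eq_0 .
  moreover have "?G 0 = vec_polymaps m d (Suc k)" by blast
  ultimately show ?case by (simp only:)
qed

section \<open>Integer-valued polynomials as polynomial maps\<close>

text \<open>Degree below \<open>k\<close>, by plain differences. Unlike \<open>polymap\<close> this
  admits constants and so behaves well under products.\<close>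

fun fin_degree :: "nat \<Rightarrow> ('v::ab_group_add \<Rightarrow> 'r::ab_group_add) \<Rightarrow> bool" where
  "fin_degree 0 h \<longleftrightarrow> (\<forall>w. h w = 0)"
| "fin_degree (Suc k) h \<longleftrightarrow> (\<forall>v. fin_degree k (\<lambda>w. h (v + w) - h w))"

lemma fin_degree_zero: "fin_degree k (\<lambda>_. 0)"
  by (induction k) auto

lemma fin_degree_Suc: "fin_degree k h \<Longrightarrow> fin_degree (Suc k) h"
proof (induction k arbitrary: h)
  case (Suc k)
  then show ?case by (subst fin_degree.simps) auto
qed auto

lemma fin_degree_mono: "fin_degree k h \<Longrightarrow> k \<le> l \<Longrightarrow> fin_degree l h"
  by (rule dec_induct[where P = "\<lambda>l. fin_degree l h"]) (auto intro: fin_degree_Suc simp del: fin_degree.simps)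

lemma fin_degree_add: "fin_degree k h \<Longrightarrow> fin_degree k h' \<Longrightarrow> fin_degree k (\<lambda>w. h w + h' w)"
proof (induction k arbitrary: h h')
  case (Suc k)
  have "fin_degree k (\<lambda>w. (h (v + w) - h w) + (h' (v + w) - h' w))" for v
    using Suc by simp
  then show ?case by (simp add: algebra_simps)
qed auto

lemma fin_degree_shift:
  assumes "fin_degree k h"
  shows "fin_degree k (\<lambda>w. h (v + w))"
proof (cases k)
  case (Suc k')
  have "fin_degree k (\<lambda>w. h (v + w) - h w)"
    using assms Suc by (intro fin_degree_Suc[of k', folded Suc]) simp
  from fin_degree_add[OF this assms] show ?thesis by simp
qed (use assms in simp)

text \<open>Leibniz rule: the difference of a product is the difference of \<open>h\<close> times
  the shifted \<open>h'\<close> plus \<open>h\<close> times the difference of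
  \<open>h'\<close>.\<close>

lemma fin_degree_mult:
  fixes h h' :: "'v::ab_group_add \<Rightarrow> 'r::comm_ring"
  shows "fin_degree k h \<Longrightarrow> fin_degree l h' \<Longrightarrow> fin_degree (k + l) (\<lambda>w. h w * h' w)"
proof (induction "k + l" arbitrary: k l h h')
  case 0
  then show ?case by auto
next
  case (Suc n)
  show ?case
  proof (cases "k = 0 \<or> l = 0")
    case True
    then have "(\<lambda>w. h w * h' w) = (\<lambda>_. 0)" using Suc.prems by auto
    then show ?thesis by (simp only: fin_degree_zero)
  next
    case False
    then obtain k' l' where kl: "k = Suc k'" "l = Suc l'" by (meson not0_implies_Suc)
    have "fin_degree n (\<lambda>w. h (v + w) * h' (v + w) - h w * h' w)" for v
    proof -
      have "fin_degree (k' + l) (\<lambda>w. (h (v + w) - h w) * h' (v + w))"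
        using Suc.prems Suc.hyps(2) kl by (intro Suc.hyps(1) fin_degree_shift) auto
      moreover have "fin_degree (k + l') (\<lambda>w. h w * (h' (v + w) - h' w))"
        using Suc.prems Suc.hyps(2) kl by (intro Suc.hyps(1)) auto
      moreover have "k' + l = n" "k + l' = n" using Suc.hyps(2) kl by auto
      ultimately have "fin_degree n (\<lambda>w. (h (v + w) - h w) * h' (v + w) + h w * (h' (v + w) - h' w))"
        by (intro fin_degree_add) auto
      then show ?thesis by (simp add: algebra_simps)
    qed
    then show ?thesis unfolding Suc.hyps(2)[symmetric] fin_degree.simps by blast
  qed
qed

lemma fin_degree_coordinate: "fin_degree (Suc (Suc 0)) (\<lambda>x. rat_of_int (x i))"
  by simp

lemma ex_fin_degree_mult:
  fixes h h' :: "'v::ab_group_add \<Rightarrow> 'r::comm_ring"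
  shows "\<exists>k. fin_degree k h \<Longrightarrow> \<exists>k. fin_degree k h' \<Longrightarrow> \<exists>k. fin_degree k (\<lambda>w. h w * h' w)"
  using fin_degree_mult by blast

lemma ex_fin_degree_sum:
  assumes "\<And>u. u \<in> I \<Longrightarrow> \<exists>k. fin_degree k (h u)"
  shows "\<exists>k. fin_degree k (\<lambda>w. \<Sum>u\<in>I. h u w)"
  using assms
proof (induction I rule: infinite_finite_induct)
  case (insert u I)
  then obtain k l where "fin_degree k (h u)" "fin_degree l (\<lambda>w. \<Sum>u\<in>I. h u w)" by blast
  then have "fin_degree (max k l) (\<lambda>w. h u w + (\<Sum>u\<in>I. h u w))"
    by (intro fin_degree_add) (auto intro: fin_degree_mono simp del: fin_degree.simps)
  then show ?case using insert by auto
qed (auto intro: fin_degree_zero)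

lemma ex_fin_degree_mpoly_eval: "\<exists>k. fin_degree k (mpoly_eval q)"
proof -
  have power: "\<exists>k. fin_degree k (\<lambda>x::nat \<Rightarrow> int. rat_of_int (x i) ^ n)" for i n
  proof (induction n)
    case (Suc n)
    have "\<exists>k. fin_degree k (\<lambda>x::nat \<Rightarrow> int. rat_of_int (x i))"
      by (rule exI) (rule fin_degree_coordinate)
    from ex_fin_degree_mult[OF this Suc] show ?case by (simp only: power_Suc)
  qed (auto intro: exI[of _ "Suc 0"])
  have prod: "\<exists>k. fin_degree k (\<lambda>x::nat \<Rightarrow> int. \<Prod>i\<in>I. rat_of_int (x i) ^ e i)" for I :: "nat set" and e
  proof (induction I rule: infinite_finite_induct)
    case (insert i I)
    then show ?case using ex_fin_degree_mult[OF power insert.IH] by simp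
  qed (auto intro: exI[of _ "Suc 0"])
  have "\<exists>k. fin_degree k (\<lambda>x::nat \<Rightarrow> int. \<Sum>u\<in>Poly_Mapping.keys q. Poly_Mapping.lookup q u *
      (\<Prod>i\<in>Poly_Mapping.keys u. rat_of_int (x i) ^ Poly_Mapping.lookup u i))"
    by (intro ex_fin_degree_sum ex_fin_degree_mult prod) (auto intro: exI[of _ "Suc 0"])
  then show ?thesis by (simp add: mpoly_eval_def[abs_def])
qed

lemma fin_degree_of_int: "fin_degree k (\<lambda>w. rat_of_int (h w)) \<longleftrightarrow> fin_degree k h"
  by (induction k arbitrary: h) (auto simp flip: of_int_diff)

lemma fin_degree_coordinates:
  fixes h :: "'v::ab_group_add \<Rightarrow> nat \<Rightarrow> int"
  shows "(\<And>i. fin_degree k (\<lambda>w. h w i)) \<Longrightarrow> fin_degree k h"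
  by (induction k arbitrary: h) (auto simp: fun_eq_iff)

text \<open>\<open>pdiff\<close> of \<open>h - h 0\<close> is the plain difference of
  \<open>h\<close> less its own value at \<open>0\<close>, so the induction passes to
  differences.\<close>

lemma polymap_if_fin_degree: "fin_degree (Suc k) h \<Longrightarrow> polymap (Suc k) (\<lambda>w. h w - h 0)"
proof (induction k arbitrary: h)
  case 0
  then have "h (v + w) = h w" for v w by simp
  from this[of _ 0] have "h v = h 0" for v by simp
  then have "h = (\<lambda>_. h 0)" by blast
  then show ?case by (subst \<open>h = _\<close>) (simp add: pdiff_def[abs_def] fun_eq_iff)
next
  case (Suc k)
  have "polymap (Suc k) (pdiff (\<lambda>w. h w - h 0) v)" for v
  proof -
    have "fin_degree (Suc k) (\<lambda>w. h (v + w) - h w)" using Suc.prems by (subst (asm) fin_degree.simps) blast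
    from Suc.IH[OF this] show ?thesis by (simp add: pdiff_def[abs_def] algebra_simps del: polymap.simps)
  qed
  then show ?case by (subst polymap.simps) blast
qed

lemma mpoly_eval_truncate:
  assumes "mpoly_in_vars m q"
  shows "mpoly_eval q (truncate m x) = mpoly_eval q x"
  using assms unfolding mpoly_eval_def mpoly_in_vars_def truncate_def
  by (intro sum.cong refl arg_cong2[where f = "(*)"] prod.cong) auto

lemma mpoly_tuple_fun_vec_polymaps:
  assumes p: "\<forall>i<d. p i \<in> int_valued_mpolys m" and p0: "mpoly_tuple_fun d p 0 = 0"
  shows "\<exists>k. mpoly_tuple_fun d p \<in> vec_polymaps m d k"
proof -
  let ?P = "mpoly_tuple_fun d p"
  have "\<exists>k. fin_degree k (\<lambda>x. ?P x i)" for i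
  proof (cases "i < d")
    case True
    then have i: "mpoly_in_vars m (p i)" "\<And>x. x \<in> int_vecs m \<Longrightarrow> mpoly_eval (p i) x \<in> \<int>"
      using p by (auto simp: int_valued_mpolys_def)
    have "rat_of_int (?P x i) = mpoly_eval (p i) x" for x
    proof -
      \<comment> \<open>Integrality is given on \<open>int_vecs m\<close> only; truncation takes any
        \<open>x\<close> there without changing the value, so the floor is exact.\<close>
      have "mpoly_eval (p i) (truncate m x) \<in> \<int>" by (rule i) (simp add: int_vecs_def truncate_def)
      then show ?thesis using True by (simp add: mpoly_tuple_fun_def mpoly_eval_truncate[OF i(1)])
    qed
    then have "\<exists>k. fin_degree k (\<lambda>x. rat_of_int (?P x i))" by (simp add: ex_fin_degree_mpoly_eval)
    then show ?thesis by (simp only: fin_degree_of_int)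
  next
    case False
    then show ?thesis by (auto simp: mpoly_tuple_fun_def intro: fin_degree_zero)
  qed
  then obtain k where k: "\<And>i. fin_degree (k i) (\<lambda>x. ?P x i)" by metis
  \<comment> \<open>Including the index \<open>d\<close> keeps the set nonempty for
    \<open>d = 0\<close>.\<close>
  define K where "K = Max (k ` {..d})"
  have "fin_degree K (\<lambda>x. ?P x i)" for i
  proof (cases "i < d")
    case True
    then show ?thesis unfolding K_def by (intro fin_degree_mono[OF k[of i]] Max_ge) auto
  qed (simp add: mpoly_tuple_fun_def fin_degree_zero)
  then have "fin_degree (Suc K) ?P" by (intro fin_degree_Suc fin_degree_coordinates)
  from polymap_if_fin_degree[OF this] have "polymap (Suc K) ?P" unfolding p0 by simp
  moreover have "?P (truncate m x) = ?P x" for x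
    using p by (auto simp: mpoly_tuple_fun_def int_valued_mpolys_def mpoly_eval_truncate)
  ultimately show ?thesis
    by (intro exI[of _ "Suc K"]) (auto simp: vec_polymaps_def int_vecs_def mpoly_tuple_fun_def simp del: polymap.simps)
qed

section \<open>Density\<close>

definition autocorrelation :: "'g::ab_group_add set \<Rightarrow> ('g \<Rightarrow> real) \<Rightarrow> 'g \<Rightarrow> real" where
  "autocorrelation I F x = (\<Sum>y\<in>I. F y * F (y + x))"

lemma sum_translate:
  fixes F G :: "'g::ab_group_add \<Rightarrow> real"
  assumes "finite W" "\<And>y. y \<in> I \<Longrightarrow> y - c \<in> W" "\<And>y. y \<notin> I \<Longrightarrow> F y = 0"
  shows "(\<Sum>u\<in>W. F (u + c) * G (u + c)) = (\<Sum>y\<in>I. F y * G y)"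
proof -
  have "(\<Sum>y\<in>I. F y * G y) = (\<Sum>u\<in>(\<lambda>y. y - c) ` I. F (u + c) * G (u + c))"
    by (subst sum.reindex) (auto simp: inj_on_def)
  also have "\<dots> = (\<Sum>u\<in>W. F (u + c) * G (u + c))"
  proof (rule sum.mono_neutral_left)
    show "\<forall>u\<in>W - (\<lambda>y. y - c) ` I. F (u + c) * G (u + c) = 0"
    proof
      fix u assume u: "u \<in> W - (\<lambda>y. y - c) ` I"
      have "u + c \<notin> I"
      proof
        assume "u + c \<in> I"
        then have "(u + c) - c \<in> (\<lambda>y. y - c) ` I" by blast
        then show False using u by simp
      qed
      then show "F (u + c) * G (u + c) = 0" using assms(3) by simp
    qed
  qed (use assms in auto)
  finally show ?thesis by simp
qed

text \<open>The form is a sum of squares over a window \<open>W\<close> that contains all translates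
  of \<open>I\<close> involved.\<close>

lemma posdef_autocorrelation:
  fixes F :: "'g::ab_group_add \<Rightarrow> real"
  assumes I: "finite I" and F: "\<And>y. y \<notin> I \<Longrightarrow> F y = 0"
  shows "posdef (autocorrelation I F)"
  unfolding posdef_def
proof (intro conjI allI)
  fix x
  let ?W = "(\<lambda>y. y - x) ` I \<union> I"
  have "autocorrelation I F (- x) = (\<Sum>u\<in>?W. F (u + x) * F (u + x - x))"
    unfolding autocorrelation_def using sum_translate[of ?W I x F "\<lambda>y. F (y - x)"] I F by simp
  also have "\<dots> = (\<Sum>u\<in>I. F (u + x) * F (u + x - x))"
    using I F by (intro sum.mono_neutral_right) auto
  finally show "autocorrelation I F (- x) = autocorrelation I F x"
    by (simp add: autocorrelation_def mult.commute)
next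
  fix n :: nat and a :: "nat \<Rightarrow> real" and x :: "nat \<Rightarrow> 'g"
  define W where "W = (\<Union>i<n. (\<lambda>y. y - x i) ` I)"
  have W: "finite W" "\<And>i y. i < n \<Longrightarrow> y \<in> I \<Longrightarrow> y - x i \<in> W" using I by (auto simp: W_def)
  have "autocorrelation I F (x i - x j) = (\<Sum>u\<in>W. F (u + x i) * F (u + x j))" if "i < n" "j < n" for i j
    unfolding autocorrelation_def
    using sum_translate[of W I "x j" F "\<lambda>y. F (y + (x i - x j))"] W that(2) F
    by (simp add: algebra_simps)
  then have "(\<Sum>i<n. \<Sum>j<n. a i * a j * autocorrelation I F (x i - x j)) =
      (\<Sum>i<n. \<Sum>j<n. \<Sum>u\<in>W. (a i * F (u + x i)) * (a j * F (u + x j)))"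
    by (intro sum.cong refl) (simp add: sum_distrib_left mult_ac)
  also have "\<dots> = (\<Sum>i<n. \<Sum>u\<in>W. \<Sum>j<n. (a i * F (u + x i)) * (a j * F (u + x j)))"
    by (intro sum.cong refl sum.swap)
  also have "\<dots> = (\<Sum>u\<in>W. \<Sum>i<n. \<Sum>j<n. (a i * F (u + x i)) * (a j * F (u + x j)))"
    by (rule sum.swap)
  also have "\<dots> = (\<Sum>u\<in>W. (\<Sum>i<n. a i * F (u + x i))\<^sup>2)"
    by (simp add: power2_eq_square sum_product)
  finally show "0 \<le> (\<Sum>i<n. \<Sum>j<n. a i * a j * autocorrelation I F (x i - x j))"
    by (simp add: sum_nonneg)
qed

lemma posdef_scale: "posdef \<phi> \<Longrightarrow> 0 \<le> c \<Longrightarrow> posdef (\<lambda>x. c * \<phi> x)"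
  unfolding posdef_def by (simp add: mult.left_commute[of _ c] flip: sum_distrib_left)

text \<open>\<open>F\<close> is the indicator of \<open>A\<close> on \<open>I\<close> minus its mean
  \<delta>. As the indicators at \<open>y\<close> and \<open>y + x\<close> have product
  \<open>0\<close>, each point contributes about \<open>- \<delta> * \<delta>\<close> on average;
  near invariance of \<open>I\<close> bounds the boundary error.\<close>

lemma balanced_autocorrelation:
  fixes A I :: "'g::ab_group_add set"
  assumes I: "finite I" and \<alpha>: "real (card (A \<inter> I)) \<ge> 7 / 8 * \<alpha> * real (card I)" "0 < \<alpha>"
    and x: "real (card (sym_diff ((\<lambda>y. x + y) ` I) I)) < \<alpha> / 8 * real (card I)"
    and A: "\<And>y. y \<in> A \<Longrightarrow> y + x \<notin> A"
    and \<delta>: "\<delta> = real (card (A \<inter> I)) / real (card I)"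
    and F: "F = (\<lambda>y. if y \<in> I then of_bool (y \<in> A) - \<delta> else 0)"
  shows "autocorrelation I F x \<le> - (\<alpha>\<^sup>2 / 2) * real (card I)"
proof -
  let ?N = "real (card I)" and ?a = "\<lambda>y. of_bool (y \<in> A) :: real"
  define I' where "I' = {y \<in> I. y + x \<in> I}"
  define I'' where "I'' = {y \<in> I. y - x \<in> I}"
  have sub: "I' \<subseteq> I" "I'' \<subseteq> I" "finite I'" "finite I''" using I by (auto simp: I'_def I''_def)
  have img: "I'' = (\<lambda>y. y + x) ` I'"
    by (auto simp: I'_def I''_def image_iff) (metis diff_add_cancel)
  have "?N > 0" using x \<alpha>(2) by (cases "card I = 0") auto
  have "card (I - I') = card ((\<lambda>y. x + y) ` (I - I'))" by (simp add: card_image)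
  also have "\<dots> \<le> card (sym_diff ((\<lambda>y. x + y) ` I) I)"
    using I by (intro card_mono) (auto simp: I'_def add.commute)
  finally have c1: "real (card (I - I')) \<le> \<alpha> / 8 * ?N" using x by linarith
  have "card I'' = card I'" unfolding img by (simp add: card_image)
  then have c2: "real (card (I - I'')) \<le> \<alpha> / 8 * ?N"
    using c1 sub by (simp add: card_Diff_subset)
  have sumA: "(\<Sum>y\<in>J. ?a y) \<ge> (\<delta> - \<alpha> / 8) * ?N"
    if "J \<subseteq> I" "real (card (I - J)) \<le> \<alpha> / 8 * ?N" for J
  proof -
    have "finite J" using that I finite_subset by blast
    have "card (A \<inter> I) \<le> card ((A \<inter> J) \<union> (I - J))"
      using I \<open>finite J\<close> by (intro card_mono) auto
    also have "\<dots> \<le> card (A \<inter> J) + card (I - J)" by (rule card_Un_le)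
    finally have "real (card (A \<inter> I)) \<le> card (A \<inter> J) + card (I - J)" by linarith
    moreover have "(\<Sum>y\<in>J. ?a y) = real (card (A \<inter> J))"
      using \<open>finite J\<close> by (simp add: of_bool_def sum.If_cases Int_commute)
    moreover have "\<delta> * ?N = real (card (A \<inter> I))" using \<delta> \<open>?N > 0\<close> by simp
    ultimately show ?thesis using that(2) by (simp add: algebra_simps)
  qed
  have \<delta>7: "\<delta> \<ge> 7 / 8 * \<alpha>" using \<alpha>(1) \<delta> \<open>?N > 0\<close> by (simp add: pos_le_divide_eq)
  then have \<delta>0: "\<delta> \<ge> 0" using \<alpha>(2) by simp
  have "autocorrelation I F x = (\<Sum>y\<in>I'. (?a y - \<delta>) * (?a (y + x) - \<delta>))"
    unfolding autocorrelation_def using I by (intro sum.mono_neutral_cong_right) (auto simp: F I'_def)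
  also have "\<dots> = (\<Sum>y\<in>I'. \<delta>\<^sup>2 - \<delta> * ?a y - \<delta> * ?a (y + x))"
  proof (intro sum.cong refl)
    fix y
    have "?a y * ?a (y + x) = 0" using A[of y] by auto
    then show "(?a y - \<delta>) * (?a (y + x) - \<delta>) = \<delta>\<^sup>2 - \<delta> * ?a y - \<delta> * ?a (y + x)"
      by (simp add: algebra_simps power2_eq_square)
  qed
  also have "\<dots> = real (card I') * \<delta>\<^sup>2 - \<delta> * (\<Sum>y\<in>I'. ?a y) - \<delta> * (\<Sum>y\<in>I''. ?a y)"
    unfolding img by (simp add: sum_subtractf sum.reindex flip: sum_distrib_left)
  also have "\<dots> \<le> ?N * \<delta>\<^sup>2 - \<delta> * ((\<delta> - \<alpha> / 8) * ?N) - \<delta> * ((\<delta> - \<alpha> / 8) * ?N)"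
    using \<delta>0 I sub c1 c2
    by (intro diff_mono mult_left_mono mult_right_mono sumA) (auto intro: card_mono)
  also have "\<dots> = - (\<delta> * (\<delta> - \<alpha> / 4)) * ?N" by (simp add: algebra_simps power2_eq_square)
  also have "\<dots> \<le> - (\<alpha>\<^sup>2 / 2) * ?N"
  proof -
    \<comment> \<open>Two boundary losses of \<open>\<alpha> / 8\<close> make up the
      \<open>\<alpha> / 4\<close>; the constant obtained is \<open>35 / 64\<close>, above
      \<open>1 / 2\<close>.\<close>
    have "(7 / 8 * \<alpha>) * (5 / 8 * \<alpha>) \<le> \<delta> * (\<delta> - \<alpha> / 4)"
      using \<delta>7 \<alpha>(2) by (intro mult_mono) auto
    moreover have "\<alpha>\<^sup>2 / 2 \<le> (7 / 8 * \<alpha>) * (5 / 8 * \<alpha>)" by (simp add: power2_eq_square)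
    ultimately show ?thesis using \<open>?N > 0\<close> by (intro mult_right_mono) auto
  qed
  finally show ?thesis .
qed

text \<open>The function is an ultrafilter limit of normalised autocorrelations of the balanced set,
  on sets \<open>I n\<close> almost invariant under growing boxes \<open>B n\<close>.\<close>

lemma posdef_from_density:
  assumes "A \<subseteq> int_vecs d" "positive_density d A"
  shows "\<exists>\<phi> \<kappa>. posdef \<phi> \<and> \<kappa> > 0 \<and> (\<forall>x\<in>int_vecs d - difference_set A. \<phi> x \<le> - \<kappa>)"
proof -
  obtain \<alpha> where \<alpha>: "\<alpha> > 0" "banach_density_ge d A \<alpha>" using assms by (auto simp: positive_density_def)
  define B where "B n = {x \<in> int_vecs d. \<forall>i. \<bar>x i\<bar> \<le> int n}" for n
  have fin: "finite (B n)" for n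
  proof -
    have "B n \<subseteq> {x. \<forall>i. (i \<in> {..<d} \<longrightarrow> x i \<in> {- int n..int n}) \<and> (i \<notin> {..<d} \<longrightarrow> x i = 0)}"
      by (auto simp: B_def int_vecs_def abs_le_iff) (metis minus_le_iff)
    then show ?thesis using finite_set_of_finite_funs[of "{..<d}" "{- int n..int n}" 0] finite_subset by blast
  qed
  have "\<exists>I. finite I \<and> real (card (A \<inter> I)) \<ge> (\<alpha> - \<alpha> / 8) * real (card I) \<and>
      (\<forall>x\<in>B n. real (card (sym_diff ((\<lambda>y. x + y) ` I) I)) < \<alpha> / 8 * real (card I))" for n
  proof -
    have "finite (B n) \<and> B n \<subseteq> int_vecs d \<and> \<alpha> / 8 > 0" using \<alpha>(1) fin by (auto simp: B_def)
    from \<alpha>(2)[unfolded banach_density_ge_def, rule_format, OF this]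
    show ?thesis by (elim exE conjE) (intro exI conjI)
  qed
  then obtain I where I: "\<And>n. finite (I n)" "\<And>n. real (card (A \<inter> I n)) \<ge> (\<alpha> - \<alpha> / 8) * real (card (I n))"
    "\<And>n x. x \<in> B n \<Longrightarrow> real (card (sym_diff ((\<lambda>y. x + y) ` I n) (I n))) < \<alpha> / 8 * real (card (I n))"
    by metis
  define F where "F n y = (if y \<in> I n then of_bool (y \<in> A) - real (card (A \<inter> I n)) / real (card (I n)) else 0 :: real)" for n y
  define f where "f n x = inverse (real (card (I n))) * autocorrelation (I n) (F n) x" for n x
  have pf: "posdef (f n)" for n
    unfolding f_def using I(1) by (intro posdef_scale posdef_autocorrelation) (auto simp: F_def)
  \<comment> \<open>Since \<open>0 \<in> B n\<close>, the strict invariance bound excludes an empty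
    \<open>I n\<close>.\<close>
  have cI: "real (card (I n)) > 0" for n
  proof -
    have "0 \<in> B n" by (simp add: B_def int_vecs_def)
    from I(3)[OF this] show ?thesis using \<alpha>(1) by (cases "card (I n) = 0") auto
  qed
  have f0: "f n 0 \<le> 1" for n
  proof -
    have "F n y * F n y \<le> 1" for y
    proof -
      have "card (A \<inter> I n) \<le> card (I n)" using I(1) by (intro card_mono) auto
      then have "real (card (A \<inter> I n)) / real (card (I n)) \<in> {0..1}" using cI[of n] by (simp add: field_simps)
      then have "\<bar>F n y\<bar> \<le> 1" by (auto simp: F_def of_bool_def)
      then show ?thesis by (metis abs_mult_self_eq abs_ge_zero mult_le_one)
    qed
    then have "autocorrelation (I n) (F n) 0 \<le> (\<Sum>y\<in>I n. 1)"
      unfolding autocorrelation_def by (intro sum_mono) simp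
    then show ?thesis using cI[of n] by (simp add: f_def field_simps)
  qed
  obtain W :: "nat filter" where W: "W \<le> sequentially" "ultrafilter W"
    using ultrafilter_exists[of sequentially] by auto
  define \<phi> where "\<phi> x = ulim W (\<lambda>n. f n x)" for x
  have lim: "((\<lambda>n. f n x) \<longlongrightarrow> \<phi> x) W" for x
    unfolding \<phi>_def
    by (rule tendsto_ulim[OF W(2), of _ 1]) (auto intro!: always_eventually order_trans[OF posdef_abs_le[OF pf] f0])
  have "\<phi> x \<le> - (\<alpha>\<^sup>2 / 2)" if x: "x \<in> int_vecs d - difference_set A" for x
  proof (rule tendsto_upperbound[OF lim _ ultrafilter_nontrivial[OF W(2)]])
    have "\<forall>\<^sub>F n in sequentially. f n x \<le> - (\<alpha>\<^sup>2 / 2)"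
    proof (rule eventually_sequentiallyI)
      fix n assume n: "nat (\<Sum>i<d. \<bar>x i\<bar>) \<le> n"
      have "\<bar>x i\<bar> \<le> int n" for i
      proof (cases "i < d")
        case True
        then have "\<bar>x i\<bar> \<le> (\<Sum>i<d. \<bar>x i\<bar>)" by (intro member_le_sum) auto
        then show ?thesis using n by linarith
      qed (use x in \<open>simp add: int_vecs_def\<close>)
      then have "x \<in> B n" using x by (simp add: B_def)
      have "y + x \<notin> A" if "y \<in> A" for y
      proof
        assume "y + x \<in> A"
        then have "(y + x) - y \<in> difference_set A" using that unfolding difference_set_def by blast
        then show False using x by simp
      qed
      then have "autocorrelation (I n) (F n) x \<le> - (\<alpha>\<^sup>2 / 2) * real (card (I n))"
        using I(1) I(2)[of n] I(3)[OF \<open>x \<in> B n\<close>] \<alpha>(1)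
        by (intro balanced_autocorrelation[where A = A]) (auto simp: F_def fun_eq_iff algebra_simps)
      then show "f n x \<le> - (\<alpha>\<^sup>2 / 2)" using cI[of n] by (simp add: f_def field_simps)
    qed
    then show "\<forall>\<^sub>F n in W. f n x \<le> - (\<alpha>\<^sup>2 / 2)" using W(1) by (simp add: le_filter_def)
  qed
  moreover have "posdef \<phi>"
    by (rule posdef_limit[OF ultrafilter_nontrivial[OF W(2)] _ lim]) (simp add: pf)
  ultimately show ?thesis using \<alpha>(1) by (intro exI[of _ \<phi>] exI[of _ "\<alpha>\<^sup>2 / 2"]) auto
qed

section \<open>Selection of the blocks\<close>

text \<open>The finite nonempty sets above \<open>n\<close> are closed under union, so the filter
  \<open>H\<close> they generate contains its own product in the sense of
  \<open>idempotent_ultrafilter_exists\<close>.\<close>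

lemma finite_sets_idempotent:
  "\<exists>U::nat set filter. idempotent_ultrafilter (\<union>) U \<and>
     (\<forall>n. \<forall>\<^sub>F a in U. finite a \<and> a \<noteq> {} \<and> a \<subseteq> {n<..})"
proof -
  define B where "B n = {a::nat set. finite a \<and> a \<noteq> {} \<and> a \<subseteq> {n<..}}" for n :: nat
  define H where "H = (INF n. principal (B n))"
  have "eventually P H \<longleftrightarrow> (\<exists>b\<in>range (\<lambda>n. principal (B n)). eventually P b)" for P
    unfolding H_def
  proof (rule eventually_Inf_base)
    fix G G' assume "G \<in> range (\<lambda>n. principal (B n))" "G' \<in> range (\<lambda>n. principal (B n))"
    then obtain n n' where n: "G = principal (B n)" "G' = principal (B n')" by blast
    have "B (max n n') \<subseteq> B n \<inter> B n'" by (auto simp: B_def)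
    then show "\<exists>x\<in>range (\<lambda>n. principal (B n)). x \<le> inf G G'"
      unfolding n by (intro bexI[of _ "principal (B (max n n'))"]) auto
  qed simp
  then have ev: "eventually P H \<longleftrightarrow> (\<exists>n. \<forall>a\<in>B n. P a)" for P
    by (auto simp: eventually_principal)
  have "\<exists>U\<le>H. idempotent_ultrafilter (\<union>) U"
  proof (rule idempotent_ultrafilter_exists)
    have "{Suc n} \<in> B n" for n by (simp add: B_def)
    then show "H \<noteq> bot" by (auto simp: trivial_limit_def ev)
    have "a \<union> b \<in> B n" if "a \<in> B n" "b \<in> B n" for a b n using that by (auto simp: B_def)
    then show "conv_filter (\<union>) H H \<le> H"
      by (auto simp: le_filter_def eventually_conv_filter ev) blast
  qed (rule Un_assoc)
  then obtain U where U: "U \<le> H" "idempotent_ultrafilter (\<union>) U" by blast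
  have "\<forall>\<^sub>F a in U. finite a \<and> a \<noteq> {} \<and> a \<subseteq> {n<..}" for n
  proof -
    have "\<forall>\<^sub>F a in H. finite a \<and> a \<noteq> {} \<and> a \<subseteq> {n<..}" unfolding ev by (auto simp: B_def)
    then show ?thesis using U(1) by (simp add: le_filter_def)
  qed
  with U(2) show ?thesis by blast
qed

text \<open>For fixed \<open>a\<close> almost every \<open>b\<close> lies beyond \<open>a\<close>,
  so sums over \<open>a \<union> b\<close> split and idempotence passes to the image.\<close>

lemma idempotent_sums:
  fixes h :: "nat \<Rightarrow> 'v::ab_group_add"
  assumes U: "idempotent_ultrafilter (\<union>) U" and fin: "\<And>n. \<forall>\<^sub>F a in U. finite a \<and> a \<subseteq> {n<..}"
  shows "idempotent_ultrafilter (+) (filtermap (\<lambda>a. \<Sum>j\<in>a. h j) U)"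
  unfolding idempotent_ultrafilter_def eventually_filtermap
proof (intro conjI allI ultrafilter_filtermap idempotent_ultra[OF U])
  fix P :: "'v \<Rightarrow> bool"
  have "\<forall>\<^sub>F a in U. (\<forall>\<^sub>F b in U. P (\<Sum>j\<in>a \<union> b. h j)) \<longleftrightarrow> (\<forall>\<^sub>F b in U. P ((\<Sum>j\<in>a. h j) + (\<Sum>j\<in>b. h j)))"
    using fin[of 0]
  proof eventually_elim
    case (elim a)
    have "\<forall>\<^sub>F b in U. P (\<Sum>j\<in>a \<union> b. h j) \<longleftrightarrow> P ((\<Sum>j\<in>a. h j) + (\<Sum>j\<in>b. h j))"
      using fin[of "Max a"]
    proof eventually_elim
      case (elim b)
      have "a \<inter> b = {}" using elim Max_ge[of a] \<open>finite a \<and> _\<close> by fastforce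
      then show ?case using elim \<open>finite a \<and> _\<close> by (simp add: sum.union_disjoint)
    qed
    then show ?case by (rule eventually_cong)
  qed
  then have "(\<forall>\<^sub>F a in U. \<forall>\<^sub>F b in U. P (\<Sum>j\<in>a \<union> b. h j)) \<longleftrightarrow>
      (\<forall>\<^sub>F a in U. \<forall>\<^sub>F b in U. P ((\<Sum>j\<in>a. h j) + (\<Sum>j\<in>b. h j)))" by (rule eventually_cong)
  moreover have "(\<forall>\<^sub>F a in U. P (\<Sum>j\<in>a. h j)) \<longleftrightarrow> (\<forall>\<^sub>F a in U. \<forall>\<^sub>F b in U. P (\<Sum>j\<in>a \<union> b. h j))"
    using U[unfolded idempotent_ultrafilter_def, THEN conjunct2, THEN spec, of "\<lambda>a. P (\<Sum>j\<in>a. h j)"] .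
  ultimately show "(\<forall>\<^sub>F a in U. P (\<Sum>j\<in>a. h j)) \<longleftrightarrow>
      (\<forall>\<^sub>F a in U. \<forall>\<^sub>F b in U. P ((\<Sum>j\<in>a. h j) + (\<Sum>j\<in>b. h j)))" by simp
qed

text \<open>Blocks are chosen one by one, keeping every tree limit of \<open>f\<close> translated by
  a sum attainable so far above a threshold. By \<open>treelim_shift\<close> almost every next block
  preserves this, and each stage imposes finitely many conditions.\<close>

lemma block_selection:
  fixes h :: "'s \<Rightarrow> nat \<Rightarrow> 'v::ab_group_add" and f :: "'v \<Rightarrow> real"
  assumes U: "idempotent_ultrafilter (\<union>) U"
    and large: "\<And>n. \<forall>\<^sub>F a in U. finite a \<and> a \<noteq> {} \<and> a \<subseteq> {n<..}"
    and \<U>: "\<U> = (\<lambda>s. filtermap (\<lambda>a. \<Sum>j\<in>a. h s j) U) ` S" and S: "finite S"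
    and B: "\<And>v. \<bar>f v\<bar> \<le> B" and nonneg: "\<And>l. l \<in> treelim \<U> \<Longrightarrow> 0 \<le> l f" and "\<kappa> > 0"
  shows "\<exists>D. (\<forall>n. finite (D n) \<and> D n \<noteq> {} \<and> set_below (D n) (D (Suc n))) \<and>
    (\<forall>F s. finite F \<and> s ` F \<subseteq> S \<longrightarrow> - \<kappa> < f (\<Sum>e\<in>F. \<Sum>j\<in>D e. h (s e) j))"
proof -
  have ultra: "\<And>V. V \<in> \<U> \<Longrightarrow> ultrafilter V"
    using ultrafilter_filtermap[OF idempotent_ultra[OF U]] by (auto simp: \<U>)
  \<comment> \<open>Thresholds falling strictly from \<open>0\<close> but staying above
    \<open>- \<kappa>\<close> permit a loss at each of infinitely many steps.\<close>
  define a where "a n = - \<kappa> * (real n / real (Suc n))" for n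
  have a0: "a 0 = 0" and a_dec: "a (Suc n) < a n" and a_gt: "- \<kappa> < a n" for n
    using \<open>\<kappa> > 0\<close> by (auto simp: a_def field_simps)
  define inv where "inv n c \<longleftrightarrow> (\<forall>l\<in>treelim \<U>. a n \<le> l (\<lambda>w. f (c + w)))" for n c
  have inv_Suc: "inv (Suc n) c" if "inv n c" for n c
    using that a_dec[of n] by (fastforce simp: inv_def)
  have extend: "\<forall>\<^sub>F D in U. inv (Suc n) (c + (\<Sum>j\<in>D. h s j))" if "inv n c" "s \<in> S" for n c s
  proof -
    have "\<forall>\<^sub>F v in filtermap (\<lambda>a. \<Sum>j\<in>a. h s j) U. \<forall>l\<in>treelim \<U>. a (Suc n) \<le> l (\<lambda>w. f (c + v + w))"
      by (rule treelim_shift[of \<U> _ f B "a n"]) (use that ultra B a_dec[of n] in \<open>auto simp: \<U> inv_def\<close>)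
    then show ?thesis by (simp add: eventually_filtermap inv_def)
  qed
  \<comment> \<open>\<open>fst X\<close> is the latest block and \<open>snd X\<close> the set of
    sums attainable so far, with \<open>0\<close> for the empty sum.\<close>
  define P where "P n X \<longleftrightarrow> finite (snd X) \<and> 0 \<in> snd X \<and> (\<forall>c\<in>snd X. inv n c) \<and>
    finite (fst X) \<and> fst X \<noteq> {}" for n and X :: "nat set \<times> 'v set"
  define Q where "Q X Y \<longleftrightarrow> set_below (fst X) (fst Y) \<and>
    snd Y = snd X \<union> (\<lambda>(c, s). c + (\<Sum>j\<in>fst Y. h s j)) ` (snd X \<times> S)" for X Y :: "nat set \<times> 'v set"
  have "\<exists>x. \<forall>n. P n (x n) \<and> Q (x n) (x (Suc n))"
  proof (rule dependent_nat_choice)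
    \<comment> \<open>The block \<open>{0}\<close> is a mere start: it enters no sum, and
      \<open>D\<close> begins with its successor.\<close>
    have "P 0 ({0}, {0})" using nonneg by (simp add: P_def inv_def a0)
    then show "\<exists>X. P 0 X" by blast
  next
    fix X n assume P: "P n X"
    have "\<forall>\<^sub>F D in U. \<forall>p\<in>snd X \<times> S. inv (Suc n) (fst p + (\<Sum>j\<in>D. h (snd p) j))"
      using P S extend by (intro eventually_ball_finite) (auto simp: P_def)
    moreover have "\<forall>\<^sub>F D in U. finite D \<and> D \<noteq> {} \<and> D \<subseteq> {Max (fst X)<..}" by (rule large)
    ultimately have "\<forall>\<^sub>F D in U. (\<forall>p\<in>snd X \<times> S. inv (Suc n) (fst p + (\<Sum>j\<in>D. h (snd p) j))) \<and>
        finite D \<and> D \<noteq> {} \<and> D \<subseteq> {Max (fst X)<..}" by (rule eventually_conj)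
    then obtain D where D: "\<And>c s. c \<in> snd X \<Longrightarrow> s \<in> S \<Longrightarrow> inv (Suc n) (c + (\<Sum>j\<in>D. h s j))"
        "finite D" "D \<noteq> {}" "D \<subseteq> {Max (fst X)<..}"
      using eventually_happens'[OF ultrafilter_nontrivial[OF idempotent_ultra[OF U]]] by fastforce
    have "set_below (fst X) D"
      unfolding set_below_def using D(4) Max_ge[of "fst X"] P by (fastforce simp: P_def)
    with P S D inv_Suc show "\<exists>Y. P (Suc n) Y \<and> Q X Y"
      by (intro exI[of _ "(D, snd X \<union> (\<lambda>(c, s). c + (\<Sum>j\<in>D. h s j)) ` (snd X \<times> S))"])
        (auto simp: P_def Q_def)
  qed
  then obtain x where x: "\<And>n. P n (x n)" "\<And>n. Q (x n) (x (Suc n))" by blast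
  define D where "D n = fst (x (Suc n))" for n
  have sums: "(\<Sum>e\<in>F. \<Sum>j\<in>D e. h (s e) j) \<in> snd (x n)" if "F \<subseteq> {..<n}" "s ` F \<subseteq> S" for F s n
    using that
  proof (induction n arbitrary: F)
    case 0
    then show ?case using x(1)[of 0] by (simp add: P_def)
  next
    case (Suc n)
    have c: "(\<Sum>e\<in>F - {n}. \<Sum>j\<in>D e. h (s e) j) \<in> snd (x n)"
      using Suc.prems by (intro Suc.IH) (auto simp: less_Suc_eq)
    have snd_Suc: "snd (x (Suc n)) = snd (x n) \<union> (\<lambda>(c, s). c + (\<Sum>j\<in>D n. h s j)) ` (snd (x n) \<times> S)"
      using x(2)[of n] by (simp add: Q_def D_def)
    show ?case
    proof (cases "n \<in> F")
      case True
      have "finite F" using Suc.prems(1) finite_subset by blast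
      then have "(\<Sum>e\<in>F. \<Sum>j\<in>D e. h (s e) j) =
          (\<lambda>(c, s). c + (\<Sum>j\<in>D n. h s j)) ((\<Sum>e\<in>F - {n}. \<Sum>j\<in>D e. h (s e) j), s n)"
        using True by (simp add: sum.remove[of F n] add.commute)
      moreover have "s n \<in> S" using True Suc.prems(2) by blast
      ultimately show ?thesis unfolding snd_Suc using c by blast
    next
      case False
      then show ?thesis using c snd_Suc by simp
    qed
  qed
  have "- \<kappa> < f (\<Sum>e\<in>F. \<Sum>j\<in>D e. h (s e) j)" if F: "finite F" "s ` F \<subseteq> S" for F s
  proof -
    obtain n where "F \<subseteq> {..<n}" using F(1) finite_nat_set_iff_bounded[of F] by auto
    from sums[OF this F(2)] have "inv n (\<Sum>e\<in>F. \<Sum>j\<in>D e. h (s e) j)" using x(1)[of n] by (simp add: P_def)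
    \<comment> \<open>Evaluation is itself a tree limit, so the threshold applies to
      \<open>f\<close> at the sum.\<close>
    then have "a n \<le> f (\<Sum>e\<in>F. \<Sum>j\<in>D e. h (s e) j)"
      using treelim_eval[of \<U>] by (force simp: inv_def)
    then show ?thesis using a_gt[of n] by simp
  qed
  moreover have "finite (D n) \<and> D n \<noteq> {} \<and> set_below (D n) (D (Suc n))" for n
    using x(1)[of "Suc n"] x(2)[of "Suc n"] by (auto simp: P_def Q_def D_def)
  ultimately show ?thesis by blast
qed

section \<open>Trees and the choice of the maps\<close>

lemma branch_through_node:
  assumes "finite_rooted_tree T" "t \<in> nodes T"
  shows "\<exists>B. tree_branch T B \<and> t \<in> B"
proof -
  let ?C = "{C. tree_chain T C \<and> t \<in> C}"
  have "finite ?C"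
    by (rule finite_subset[of _ "Pow (nodes T)"])
      (use assms in \<open>auto simp: tree_chain_def pred_on.chain_def finite_rooted_tree_def\<close>)
  moreover have "{t} \<in> ?C"
    using assms by (auto simp: tree_chain_def pred_on.chain_def tree_le_def)
  ultimately obtain C where C: "C \<in> ?C" "\<forall>C'\<in>?C. C \<subseteq> C' \<longrightarrow> C = C'"
    using finite_has_maximal2[of ?C "{t}"] by blast
  then have "tree_branch T C"
    unfolding tree_branch_def pred_on.maxchain_def tree_chain_def by blast
  with C(1) show ?thesis by blast
qed

lemma const_in_FIN_at:
  assumes T: "finite_rooted_tree T" and t: "t \<in> nodes T" "t \<noteq> root T" and D: "finite D" "D \<noteq> {}"
  shows "(\<lambda>j. if j \<in> D then Some t else None) \<in> FIN_at T t"
proof -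
  have dom: "dom (\<lambda>j. if j \<in> D then Some t else None) = D" by (auto split: if_splits)
  have ran: "ran (\<lambda>j. if j \<in> D then Some t else None) = {t}" using D by (auto simp: ran_def)
  have "tree_chain T {t}" using t by (auto simp: tree_chain_def pred_on.chain_def tree_le_def)
  then show ?thesis
    using t D branch_through_node[OF T t(1)]
    by (auto simp: FIN_at_def FIN_def dom ran nonroot_def tree_le_def)
qed

theorem theorem7p6:
  fixes m d :: nat
    and p :: "nat \<Rightarrow> rat_mpoly"
    and T :: "'a rtree"
    and g :: "nat \<Rightarrow> 'a \<Rightarrow> (nat \<Rightarrow> int)"
    and A :: "(nat \<Rightarrow> int) set"
  assumes "\<forall>i<d. p i \<in> int_valued_mpolys m"
    and "mpoly_tuple_fun d p 0 = 0"
    and "finite_rooted_tree T"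
    and "\<forall>n. \<forall>t \<in> nonroot T. g n t \<in> int_vecs m"
    and "A \<subseteq> int_vecs d"
    and "positive_density d A"
  shows "\<exists>b :: nat \<Rightarrow> 'a \<Rightarrow> (nat \<rightharpoonup> 'a).
    (\<forall>n. \<forall>t \<in> nodes T. b n t \<in> FIN_at T t) \<and>
    (\<forall>n. \<forall>t \<in> nodes T. set_below (dom (b n t)) (dom (b (Suc n) t))) \<and>
    (\<forall>(F :: nat set) (f :: nat \<Rightarrow> 'a \<Rightarrow> 'a) (t :: nat \<Rightarrow> 'a).
       finite F \<and> F \<noteq> {} \<and>
       (\<forall>e\<in>F. regressive_hom T (f e)) \<and>
       (\<forall>e\<in>F. t e \<in> nodes T) \<and>
       tree_chain T ((\<lambda>e. f e (t e)) ` F) \<longrightarrow>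
       mpoly_tuple_fun d p
         (\<Sum>e\<in>F. \<Sum>j \<in> {j \<in> dom (b e (t e)). f e (the (b e (t e) j)) \<in> nonroot T}.
            g j (f e (the (b e (t e) j))))
       \<in> difference_set A)"
proof -
  let ?P = "mpoly_tuple_fun d p"
  obtain k where k: "?P \<in> vec_polymaps m d k"
    using mpoly_tuple_fun_vec_polymaps[OF assms(1,2)] by blast
  obtain \<phi> \<kappa> where \<phi>: "posdef \<phi>" "\<kappa> > 0" "\<And>x. x \<in> int_vecs d - difference_set A \<Longrightarrow> \<phi> x \<le> - \<kappa>"
    using posdef_from_density[OF assms(5,6)] by blast
  obtain U :: "nat set filter" where U: "idempotent_ultrafilter (\<union>) U"
    "\<And>n. \<forall>\<^sub>F a in U. finite a \<and> a \<noteq> {} \<and> a \<subseteq> {n<..}"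
    using finite_sets_idempotent by blast
  \<comment> \<open>One ultrafilter on vectors per non-root node, all of them images of the same
    \<open>U\<close>, so that one block serves every node.\<close>
  define \<U> where "\<U> = (\<lambda>s. filtermap (\<lambda>a. \<Sum>j\<in>a. g j s) U) ` nonroot T"
  have fin: "finite (nonroot T)" using assms(3) by (auto simp: finite_rooted_tree_def nonroot_def)
  have "0 \<le> l (\<lambda>w. \<phi> (?P w))" if "l \<in> treelim \<U>" for l
  proof (rule treelim_nonneg[OF _ _ subgrp_vec_polymaps noeth_vec_polymaps _ _ that k \<phi>(1)])
    show "finite \<U>" using fin by (simp add: \<U>_def)
    show "idempotent_ultrafilter (+) V" if "V \<in> \<U>" for V
    proof -
      have "\<forall>\<^sub>F a in U. finite a \<and> a \<subseteq> {n<..}" for n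
        using U(2)[of n] by (rule eventually_mono) simp
      from idempotent_sums[OF U(1) this] show ?thesis using that by (auto simp: \<U>_def)
    qed
  qed (auto simp: pdiff_vec_polymaps, auto simp: vec_polymaps_def)
  then have "\<exists>D. (\<forall>n. finite (D n) \<and> D n \<noteq> {} \<and> set_below (D n) (D (Suc n))) \<and>
    (\<forall>F s. finite F \<and> s ` F \<subseteq> nonroot T \<longrightarrow> - \<kappa> < \<phi> (?P (\<Sum>e\<in>F. \<Sum>j\<in>D e. g j (s e))))"
    using posdef_abs_le[OF \<phi>(1)] \<phi>(2) by (intro block_selection[OF U \<U>_def fin, of _ "\<phi> 0"]) auto
  then obtain D where D: "\<And>n. finite (D n)" "\<And>n. D n \<noteq> {}" "\<And>n. set_below (D n) (D (Suc n))"
    "\<And>F s. finite F \<Longrightarrow> s ` F \<subseteq> nonroot T \<Longrightarrow> - \<kappa> < \<phi> (?P (\<Sum>e\<in>F. \<Sum>j\<in>D e. g j (s e)))"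
    by metis
  define b where "b n t = (if t = root T then Map.empty else (\<lambda>j. if j \<in> D n then Some t else None))" for n t
  have dom_b: "dom (b n t) = (if t = root T then {} else D n)" for n t
    by (auto simp: b_def split: if_splits)
  show ?thesis
  proof (intro exI[of _ b] conjI allI ballI impI)
    fix n t assume "t \<in> nodes T"
    then show "b n t \<in> FIN_at T t"
      using const_in_FIN_at[OF assms(3) _ _ D(1,2)] by (auto simp: b_def FIN_at_def[of T "root T"])
    show "set_below (dom (b n t)) (dom (b (Suc n) t))"
      using D(3) by (simp add: dom_b set_below_def)
  next
    fix F :: "nat set" and f :: "nat \<Rightarrow> 'a \<Rightarrow> 'a" and t :: "nat \<Rightarrow> 'a"
    assume F: "finite F \<and> F \<noteq> {} \<and> (\<forall>e\<in>F. regressive_hom T (f e)) \<and>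
       (\<forall>e\<in>F. t e \<in> nodes T) \<and> tree_chain T ((\<lambda>e. f e (t e)) ` F)"
    \<comment> \<open>Only these indices contribute: the map at the root is empty, and a constant
      map whose value is sent to the root adds nothing.\<close>
    define F' where "F' = {e \<in> F. t e \<noteq> root T \<and> f e (t e) \<in> nonroot T}"
    let ?sum = "\<lambda>e. \<Sum>j\<in>{j \<in> dom (b e (t e)). f e (the (b e (t e) j)) \<in> nonroot T}. g j (f e (the (b e (t e) j)))"
    have "?sum e = (if e \<in> F' then \<Sum>j\<in>D e. g j (f e (t e)) else 0)" if "e \<in> F" for e
      using that by (auto simp: F'_def dom_b b_def intro!: sum.cong sum.neutral split: if_splits)
    then have "(\<Sum>e\<in>F. ?sum e) = (\<Sum>e\<in>F. if e \<in> F' then \<Sum>j\<in>D e. g j (f e (t e)) else 0)"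
      by (intro sum.cong) auto
    also have "\<dots> = (\<Sum>e\<in>F'. \<Sum>j\<in>D e. g j (f e (t e)))"
      using F by (simp add: sum.If_cases F'_def Int_def)
    finally have eq: "(\<Sum>e\<in>F. ?sum e) = (\<Sum>e\<in>F'. \<Sum>j\<in>D e. g j (f e (t e)))" .
    have "- \<kappa> < \<phi> (?P (\<Sum>e\<in>F'. \<Sum>j\<in>D e. g j (f e (t e))))"
      by (rule D(4)) (use F in \<open>auto simp: F'_def\<close>)
    then have "\<not> \<phi> (?P (\<Sum>e\<in>F. ?sum e)) \<le> - \<kappa>" unfolding eq by simp
    moreover have "?P (\<Sum>e\<in>F. ?sum e) \<in> int_vecs d" using k by (simp add: vec_polymaps_def)
    ultimately show "?P (\<Sum>e\<in>F. ?sum e) \<in> difference_set A" using \<phi>(3) by blast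
  qed
qed

end
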